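(* Let $G$ be a graph on vertices $\{1,\dots,n\}$ with maximum degree $\Delta$, let $\pi$ be a permutation of $\{1,\dots,n\}$ and let $k$ be a positive integer. Then one can construct, in time polynomial in $n$ and $(\Delta+1)^k$, a graph $G_{clique}$ with $|V(G_{clique})|=O(n(\Delta+1)^k)$ such that the clique number of $G_{clique}$ equals $mr(G,\pi,k)$.
   Context: Routing via matchings: initially every vertex $v$ of $G$ holds a pebble $p_v$; a step consists of choosing a matching of $G$ and swapping the pebbles on the endpoints of each matched edge; for a permutation $\sigma$, $rt(G,\sigma)$ is the minimum number of steps after which every pebble $p_v$ lies on $\sigma(v)$. For permutations $\pi,\sigma$ of $\{1,\dots,n\}$, $|\pi-\sigma|$ denotes the number of fixed points of the permutation $\tau$ with $\tau\pi=\sigma$. The maximum routability is $mr(G,\pi,k)=\max\{|\pi-\sigma| : \sigma\in S_n,\ rt(G,\sigma)\le k\}$. *)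

theory Defs
  imports "HOL-Combinatorics.Permutations" "HOL-Library.Extended_Nat"
begin

section \<open>Finite simple graphs on the vertices 1, ..., n\<close>

definition simple_graph :: "nat \<Rightarrow> nat set set \<Rightarrow> bool" where
  "simple_graph n E \<longleftrightarrow> (\<forall>e\<in>E. e \<subseteq> {1..n} \<and> card e = 2)"

definition degree :: "nat set set \<Rightarrow> nat \<Rightarrow> nat" where
  "degree E v = card {e \<in> E. v \<in> e}"

text \<open>The inserted \<open>0\<close> only matters for the graph without vertices.\<close>

definition max_degree :: "nat \<Rightarrow> nat set set \<Rightarrow> nat" where
  "max_degree n E = Max (insert 0 (degree E ` {1..n}))"

definition clique :: "nat \<Rightarrow> nat set set \<Rightarrow> nat set \<Rightarrow> bool" where
  "clique n E S \<longleftrightarrow> S \<subseteq> {1..n} \<and> (\<forall>u\<in>S. \<forall>v\<in>S. u \<noteq> v \<longrightarrow> {u, v} \<in> E)"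

definition clique_number :: "nat \<Rightarrow> nat set set \<Rightarrow> nat" where
  "clique_number n E = Max {card S | S. clique n E S}"

section \<open>Routing via matchings\<close>

definition matching :: "nat set set \<Rightarrow> nat set set \<Rightarrow> bool" where
  "matching E M \<longleftrightarrow> M \<subseteq> E \<and> pairwise disjnt M"

definition swap_along :: "nat set set \<Rightarrow> nat \<Rightarrow> nat" where
  "swap_along M x = (if \<exists>y. {x, y} \<in> M then THE y. {x, y} \<in> M else x)"

text \<open>\<open>position Ms v\<close> is the vertex carrying the pebble \<open>p\<^sub>v\<close> after the steps \<open>Ms\<close>, first step first.\<close>

definition position :: "nat set set list \<Rightarrow> nat \<Rightarrow> nat" where
  "position Ms v = fold swap_along Ms v"

text \<open>The value is \<open>\<infinity>\<close> if \<open>\<sigma>\<close> cannot be routed, e.g. between different components.\<close>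

definition rt :: "nat \<Rightarrow> nat set set \<Rightarrow> (nat \<Rightarrow> nat) \<Rightarrow> enat" where
  "rt n E \<sigma> = (INF Ms \<in> {Ms. (\<forall>M\<in>set Ms. matching E M) \<and> (\<forall>v\<in>{1..n}. position Ms v = \<sigma> v)}.
      enat (length Ms))"

text \<open>The quantity written \<open>|\<pi> - \<sigma>|\<close>; it counts agreements, not differences.\<close>

definition perm_agreement :: "nat \<Rightarrow> (nat \<Rightarrow> nat) \<Rightarrow> (nat \<Rightarrow> nat) \<Rightarrow> nat" where
  "perm_agreement n \<pi> \<sigma> =
     (let \<tau> = (THE \<tau>. \<tau> permutes {1..n} \<and> \<tau> \<circ> \<pi> = \<sigma>) in card {i \<in> {1..n}. \<tau> i = i})"

definition mr :: "nat \<Rightarrow> nat set set \<Rightarrow> (nat \<Rightarrow> nat) \<Rightarrow> nat \<Rightarrow> nat" where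
  "mr n E \<pi> k = Max {perm_agreement n \<pi> \<sigma> | \<sigma>. \<sigma> permutes {1..n} \<and> rt n E \<sigma> \<le> enat k}"

section \<open>A model of computation with running time\<close>

text \<open>
  Programs are first-order, call-by-value recursive functions on binary trees, with the constructors
  and destructors of trees as the only primitives (pure LISP; the language F of N. D. Jones,
  Computability and Complexity from a Programming Perspective, MIT Press 1997, here with several
  functions of several arguments). The running time counts evaluated expressions. Trees are shared
  and never copied or compared, so each of these steps is a bounded number of pointer operations, and
  the model agrees with Turing machines up to a polynomial.
\<close>

datatype tree = Atom | Pair tree tree

fun left :: "tree \<Rightarrow> tree" where
  "left Atom = Atom"
| "left (Pair a b) = a"

fun right :: "tree \<Rightarrow> tree" where
  "right Atom = Atom"
| "right (Pair a b) = b"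

text \<open>
  \<open>Param i\<close> is the \<open>i\<close>-th argument of the enclosing function (from 0), and \<open>Call f es\<close> calls the
  \<open>f\<close>-th function. A program is the list of its function bodies; function 0 is the entry point.
\<close>

datatype expr =
    Param nat
  | AtomE
  | PairE expr expr
  | LeftE expr
  | RightE expr
  | IfPair expr expr expr
  | Call nat "expr list"

type_synonym program = "expr list"

inductive
  evaluates :: "program \<Rightarrow> tree list \<Rightarrow> expr \<Rightarrow> tree \<Rightarrow> nat \<Rightarrow> bool" and
  evaluates_list :: "program \<Rightarrow> tree list \<Rightarrow> expr list \<Rightarrow> tree list \<Rightarrow> nat \<Rightarrow> bool"
  for P :: program
where
  Param: "i < length xs \<Longrightarrow> evaluates P xs (Param i) (xs ! i) 1"
| AtomE: "evaluates P xs AtomE Atom 1"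
| PairE: "evaluates P xs e1 a s \<Longrightarrow> evaluates P xs e2 b t \<Longrightarrow>
    evaluates P xs (PairE e1 e2) (Pair a b) (1 + s + t)"
| LeftE: "evaluates P xs e a s \<Longrightarrow> evaluates P xs (LeftE e) (left a) (1 + s)"
| RightE: "evaluates P xs e a s \<Longrightarrow> evaluates P xs (RightE e) (right a) (1 + s)"
| IfPair_True: "evaluates P xs e (Pair a b) s \<Longrightarrow> evaluates P xs e1 c t \<Longrightarrow>
    evaluates P xs (IfPair e e1 e2) c (1 + s + t)"
| IfPair_False: "evaluates P xs e Atom s \<Longrightarrow> evaluates P xs e2 c t \<Longrightarrow>
    evaluates P xs (IfPair e e1 e2) c (1 + s + t)"
| Call: "f < length P \<Longrightarrow> evaluates_list P xs es ys s \<Longrightarrow> evaluates P ys (P ! f) c t \<Longrightarrow>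
    evaluates P xs (Call f es) c (1 + s + t)"
| Nil: "evaluates_list P xs [] [] 0"
| Cons: "evaluates P xs e a s \<Longrightarrow> evaluates_list P xs es as t \<Longrightarrow>
    evaluates_list P xs (e # es) (a # as) (s + t)"

inductive_cases evaluates_elims:
  "evaluates P xs (Param i) c t"
  "evaluates P xs AtomE c t"
  "evaluates P xs (PairE e1 e2) c t"
  "evaluates P xs (LeftE e) c t"
  "evaluates P xs (RightE e) c t"
  "evaluates P xs (IfPair e e1 e2) c t"
  "evaluates P xs (Call f es) c t"
  "evaluates_list P xs [] cs t"
  "evaluates_list P xs (e # es) cs t"

lemma
  shows evaluates_deterministic:
    "evaluates P xs e c t \<Longrightarrow> evaluates P xs e c' t' \<Longrightarrow> c' = c \<and> t' = t"
  and evaluates_list_deterministic: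
    "evaluates_list P xs es cs t \<Longrightarrow> evaluates_list P xs es cs' t' \<Longrightarrow> cs' = cs \<and> t' = t"
proof (induction arbitrary: c' t' and cs' t' rule: evaluates_evaluates_list.inducts)
  case (PairE xs e1 a s e2 b t)
  from PairE.prems show ?case by (elim evaluates_elims(3)) (auto dest!: PairE.IH(2,4))
next
  case (LeftE xs e a s)
  from LeftE.prems show ?case by (elim evaluates_elims(4)) (auto dest!: LeftE.IH(2))
next
  case (RightE xs e a s)
  from RightE.prems show ?case by (elim evaluates_elims(5)) (auto dest!: RightE.IH(2))
next
  case (IfPair_True xs e a b s e1 c t e2)
  from IfPair_True.prems show ?case by (elim evaluates_elims(6)) (auto dest!: IfPair_True.IH(2,4))
next
  case (IfPair_False xs e s e2 c t e1)
  from IfPair_False.prems show ?case by (elim evaluates_elims(6)) (auto dest!: IfPair_False.IH(2,4))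
next
  case (Call f xs es ys s c t)
  from Call.prems show ?case by (elim evaluates_elims(7)) (auto dest!: Call.IH(3,5))
next
  case (Cons xs e a s es as t)
  from Cons.prems show ?case by (elim evaluates_elims(9)) (auto dest!: Cons.IH(2,4))
qed (auto elim: evaluates_elims(1,2,8))

text \<open>On the given inputs the program halts with the given output after exactly \<open>t\<close> steps.\<close>

definition computes_in :: "program \<Rightarrow> tree list \<Rightarrow> tree \<Rightarrow> nat \<Rightarrow> bool" where
  "computes_in P inputs output t \<longleftrightarrow> P \<noteq> [] \<and> evaluates P inputs (P ! 0) output t"

section \<open>Encoding of inputs and outputs\<close>

fun encode_nat :: "nat \<Rightarrow> tree" where
  "encode_nat 0 = Atom"
| "encode_nat (Suc m) = Pair Atom (encode_nat m)"

fun encode_bool :: "bool \<Rightarrow> tree" where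
  "encode_bool False = Atom"
| "encode_bool True = Pair Atom Atom"

fun encode_list :: "('a \<Rightarrow> tree) \<Rightarrow> 'a list \<Rightarrow> tree" where
  "encode_list enc [] = Atom"
| "encode_list enc (x # xs) = Pair (enc x) (encode_list enc xs)"

definition adjacency_matrix :: "nat \<Rightarrow> nat set set \<Rightarrow> bool list list" where
  "adjacency_matrix n E = map (\<lambda>u. map (\<lambda>v. {u, v} \<in> E) [1..<Suc n]) [1..<Suc n]"

definition encode_graph :: "nat \<Rightarrow> nat set set \<Rightarrow> tree" where
  "encode_graph n E =
     Pair (encode_nat n) (encode_list (encode_list encode_bool) (adjacency_matrix n E))"

definition encode_perm :: "nat \<Rightarrow> (nat \<Rightarrow> nat) \<Rightarrow> tree" where
  "encode_perm n \<pi> = encode_list encode_nat (map \<pi> [1..<Suc n])"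

end

theory Submission
  imports Defs "HOL-Library.Monad_Syntax"
begin

text \<open>
  The vertices of the clique graph are the lazy walks of length \<open>k\<close> that lead from some vertex \<open>v\<close> to
  \<open>\<pi> v\<close>; there are at most \<open>n (\<Delta> + 1)\<^sup>k\<close> of them. Two walks are adjacent if they are at different
  vertices at all times and if, whenever one of them moves along an edge and the other one starts at
  the far end of that edge, they swap. Adjacent walks make equal or disjoint moves in each step, so a
  clique is carried by \<open>k\<close> matchings, which send its pebbles to their targets under \<open>\<pi>\<close>. Conversely,
  the trajectories of the pebbles in a routing are pairwise adjacent, and those of the pebbles that
  arrive at their targets form a clique.

  If \<open>G\<close> has an edge then \<open>k \<le> 2\<^sup>k \<le> (\<Delta> + 1)\<^sup>k\<close>, so the \<open>k\<close> rounds of the enumeration are affordable.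
  If \<open>G\<close> has no edge then \<open>(\<Delta> + 1)\<^sup>k = 1\<close> gives no bound on \<open>k\<close>; but then nothing moves, and the
  program replaces \<open>k\<close> by \<open>0\<close>.
\<close>

section \<open>Evaluation as a partial function\<close>

text \<open>Since evaluation is deterministic, it is a partial function. In this form the simplifier
  can run a function body by rewriting, with \<open>None\<close> for a run without a result.\<close>

definition outcome :: "program \<Rightarrow> tree list \<Rightarrow> expr \<Rightarrow> (tree \<times> nat) option" where
  "outcome P xs e =
     (if \<exists>r. evaluates P xs e (fst r) (snd r)
      then Some (THE r. evaluates P xs e (fst r) (snd r)) else None)"

definition outcome_list :: "program \<Rightarrow> tree list \<Rightarrow> expr list \<Rightarrow> (tree list \<times> nat) option" where
  "outcome_list P xs es =
     (if \<exists>r. evaluates_list P xs es (fst r) (snd r)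
      then Some (THE r. evaluates_list P xs es (fst r) (snd r)) else None)"

lemma outcome_eq_Some: "outcome P xs e = Some (c, t) \<longleftrightarrow> evaluates P xs e c t"
proof
  assume ev: "evaluates P xs e c t"
  then have "(THE r. evaluates P xs e (fst r) (snd r)) = (c, t)"
    by (intro the_equality) (auto dest: evaluates_deterministic)
  with ev show "outcome P xs e = Some (c, t)"
    by (auto simp: outcome_def)
next
  assume some: "outcome P xs e = Some (c, t)"
  then obtain a s where ev: "evaluates P xs e a s"
    by (auto simp: outcome_def split: if_splits)
  then have "(THE r. evaluates P xs e (fst r) (snd r)) = (a, s)"
    by (intro the_equality) (auto dest: evaluates_deterministic)
  with some ev show "evaluates P xs e c t"
    by (auto simp: outcome_def split: if_splits)
qed

lemma outcome_list_eq_Some: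
  "outcome_list P xs es = Some (cs, t) \<longleftrightarrow> evaluates_list P xs es cs t"
proof
  assume ev: "evaluates_list P xs es cs t"
  then have "(THE r. evaluates_list P xs es (fst r) (snd r)) = (cs, t)"
    by (intro the_equality) (auto dest: evaluates_list_deterministic)
  with ev show "outcome_list P xs es = Some (cs, t)"
    by (auto simp: outcome_list_def)
next
  assume some: "outcome_list P xs es = Some (cs, t)"
  then obtain a s where ev: "evaluates_list P xs es a s"
    by (auto simp: outcome_list_def split: if_splits)
  then have "(THE r. evaluates_list P xs es (fst r) (snd r)) = (a, s)"
    by (intro the_equality) (auto dest: evaluates_list_deterministic)
  with some ev show "evaluates_list P xs es cs t"
    by (auto simp: outcome_list_def split: if_splits)
qed

lemma option_pair_eqI:
  assumes "\<And>c t. x = Some (c, t) \<longleftrightarrow> y = Some (c, t)"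
  shows "x = y"
  using assms by (metis not_None_eq surj_pair)

lemma outcome_simps [simp]:
  "outcome P xs (Param i) = (if i < length xs then Some (xs ! i, 1) else None)"
  "outcome P xs AtomE = Some (Atom, 1)"
  "outcome P xs (PairE e1 e2) =
     do {(a, s) \<leftarrow> outcome P xs e1; (b, t) \<leftarrow> outcome P xs e2; Some (Pair a b, 1 + s + t)}"
  "outcome P xs (LeftE e) = do {(a, s) \<leftarrow> outcome P xs e; Some (left a, 1 + s)}"
  "outcome P xs (RightE e) = do {(a, s) \<leftarrow> outcome P xs e; Some (right a, 1 + s)}"
  "outcome P xs (IfPair e e1 e2) =
     do {(b, s) \<leftarrow> outcome P xs e; (c, t) \<leftarrow> outcome P xs (if b = Atom then e2 else e1);
         Some (c, 1 + s + t)}"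
  "outcome P xs (Call f es) =
     do {(ys, s) \<leftarrow> outcome_list P xs es;
         (c, t) \<leftarrow> (if f < length P then outcome P ys (P ! f) else None);
         Some (c, 1 + s + t)}"
proof -
  show "outcome P xs (IfPair e e1 e2) =
     do {(b, s) \<leftarrow> outcome P xs e; (c, t) \<leftarrow> outcome P xs (if b = Atom then e2 else e1);
         Some (c, 1 + s + t)}"
  proof (rule option_pair_eqI)
    fix c t
    show "outcome P xs (IfPair e e1 e2) = Some (c, t) \<longleftrightarrow>
       do {(b, s) \<leftarrow> outcome P xs e; (c, t) \<leftarrow> outcome P xs (if b = Atom then e2 else e1);
         Some (c, 1 + s + t)} = Some (c, t)" (is "?l \<longleftrightarrow> ?r")
    proof
      assume ?l
      then have "evaluates P xs (IfPair e e1 e2) c t" by (simp add: outcome_eq_Some)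
      then show ?r
        by (elim evaluates_elims(6)) (auto simp flip: outcome_eq_Some)
    next
      assume ?r
      then obtain b s u where "outcome P xs e = Some (b, s)"
        "outcome P xs (if b = Atom then e2 else e1) = Some (c, u)" "t = 1 + s + u"
        by (auto simp: bind_eq_Some_conv)
      \<comment> \<open>\<open>[simplified]\<close> turns the time \<open>1 + s + t\<close> in the
        rules into \<open>Suc (s + t)\<close>, the form that \<open>auto\<close> gives to the
        goal.\<close>
      then show ?l
        by (cases b) (auto simp: outcome_eq_Some intro: IfPair_True[simplified] IfPair_False[simplified])
    qed
  qed
qed ((rule option_pair_eqI,
      auto simp: bind_eq_Some_conv outcome_eq_Some outcome_list_eq_Some
        elim!: evaluates_elims(1-5,7) intro: evaluates_evaluates_list.intros[simplified]
        split: if_splits)+)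

lemma outcome_list_simps [simp]:
  "outcome_list P xs [] = Some ([], 0)"
  "outcome_list P xs (e # es) =
     do {(a, s) \<leftarrow> outcome P xs e; (as, t) \<leftarrow> outcome_list P xs es; Some (a # as, s + t)}"
  by (rule option_pair_eqI,
      auto simp: bind_eq_Some_conv outcome_eq_Some outcome_list_eq_Some
        elim!: evaluates_elims(8,9) intro: evaluates_evaluates_list.intros)+

section \<open>The program\<close>

text \<open>Walks are stored in reverse, most recent vertex first.\<close>

fun compatible :: "nat list \<Rightarrow> nat list \<Rightarrow> bool" where
  "compatible (b # a # l) (d # c # l') \<longleftrightarrow> b \<noteq> d \<and> (a = d \<longleftrightarrow> b = c) \<and> compatible (a # l) (c # l')"
| "compatible [b] [d] \<longleftrightarrow> b \<noteq> d"
| "compatible _ _ \<longleftrightarrow> False"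

text \<open>The pair \<open>(g, l)\<close> is a walk \<open>l\<close> together with the target \<open>g\<close> of the pebble that started it.\<close>

fun encode_walk :: "nat \<times> nat list \<Rightarrow> tree" where
  "encode_walk (g, l) = Pair (encode_nat g) (encode_list encode_nat l)"

text \<open>This function and the next two follow the recursion of the program, so that each run is
  verified by the matching induction. Descriptions as sets and filtered intervals are derived
  later.\<close>

fun starts :: "nat \<Rightarrow> nat list \<Rightarrow> (nat \<times> nat list) list" where
  "starts i [] = []"
| "starts i (g # gs) = (g, [i]) # starts (Suc i) gs"

text \<open>\<open>bs\<close> is the unread rest of an adjacency row, and \<open>i\<close> is the
  vertex that its first entry stands for.\<close>

fun moves :: "bool list \<Rightarrow> nat \<Rightarrow> nat \<times> nat list \<Rightarrow> (nat \<times> nat list) list" where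
  "moves [] i w = []"
| "moves (b # bs) i w =
     (if b then (fst w, i # snd w) # moves bs (Suc i) w else moves bs (Suc i) w)"

text \<open>Each walk first yields the one that waits, then those that move. Rows are indexed from
  0, so vertex \<open>v\<close> owns row \<open>v - 1\<close>.\<close>

fun extend :: "bool list list \<Rightarrow> (nat \<times> nat list) list \<Rightarrow> (nat \<times> nat list) list" where
  "extend A [] = []"
| "extend A (w # ws) =
     ((fst w, hd (snd w) # snd w) # moves (A ! (hd (snd w) - 1)) 1 w) @ extend A ws"

definition arrived :: "nat \<times> nat list \<Rightarrow> bool" where
  "arrived w \<longleftrightarrow> fst w = hd (snd w)"

text \<open>Names for the positions of the functions in \<open>prog\<close>. \<open>Suc 0\<close> is
  the form in which the simplifier keeps the number 1.\<close>

abbreviation (input) "OUTPUT \<equiv> Suc 0"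
abbreviation (input) "ROW_HAS_EDGE \<equiv> 2 :: nat"
abbreviation (input) "HAS_EDGE \<equiv> 3 :: nat"
abbreviation (input) "STARTS \<equiv> 4 :: nat"
abbreviation (input) "NTH \<equiv> 5 :: nat"
abbreviation (input) "MOVES \<equiv> 6 :: nat"
abbreviation (input) "EXTEND \<equiv> 7 :: nat"
abbreviation (input) "WALKS \<equiv> 8 :: nat"
abbreviation (input) "EQ \<equiv> 9 :: nat"
abbreviation (input) "ARRIVED \<equiv> 10 :: nat"
abbreviation (input) "COMPAT \<equiv> 11 :: nat"
abbreviation (input) "ROW \<equiv> 12 :: nat"
abbreviation (input) "ROWS \<equiv> 13 :: nat"
abbreviation (input) "LENGTH \<equiv> 14 :: nat"

section \<open>The bodies of the functions\<close>

abbreviation (input) "TrueE \<equiv> PairE AtomE AtomE"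
abbreviation (input) "SucE e \<equiv> PairE AtomE e"

text \<open>The language has no local binding. Passing the surviving walks to \<open>OUTPUT\<close>
  computes them once although they are used three times. \<open>AtomE\<close> in the conditional
  encodes the number 0 of rounds.\<close>

definition main_body :: expr where
  "main_body =
     Call OUTPUT [Call ARRIVED [Call WALKS
       [RightE (Param 0),
        IfPair (Call HAS_EDGE [RightE (Param 0)]) (Param 2) AtomE,
        Call STARTS [SucE AtomE, Param 1]]]]"

definition output_body :: expr where
  "output_body = PairE (Call LENGTH [Param 0]) (Call ROWS [Param 0, Param 0])"

definition row_has_edge_body :: expr where
  "row_has_edge_body =
     IfPair (Param 0) (IfPair (LeftE (Param 0)) TrueE (Call ROW_HAS_EDGE [RightE (Param 0)])) AtomE"

definition has_edge_body :: expr where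
  "has_edge_body =
     IfPair (Param 0)
       (IfPair (Call ROW_HAS_EDGE [LeftE (Param 0)]) TrueE (Call HAS_EDGE [RightE (Param 0)]))
       AtomE"

definition starts_body :: expr where
  "starts_body =
     IfPair (Param 1)
       (PairE (PairE (LeftE (Param 1)) (PairE (Param 0) AtomE))
         (Call STARTS [SucE (Param 0), RightE (Param 1)]))
       AtomE"

definition nth_body :: expr where
  "nth_body = IfPair (Param 1) (Call NTH [RightE (Param 0), RightE (Param 1)]) (LeftE (Param 0))"

text \<open>The last argument is the list to which the new walks are prepended.\<close>

definition moves_body :: expr where
  "moves_body =
     IfPair (Param 0)
       (IfPair (LeftE (Param 0))
         (PairE (PairE (LeftE (Param 2)) (PairE (Param 1) (RightE (Param 2))))
           (Call MOVES [RightE (Param 0), SucE (Param 1), Param 2, Param 3]))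
         (Call MOVES [RightE (Param 0), SucE (Param 1), Param 2, Param 3]))
       (Param 3)"

text \<open>The remaining walks are extended first and handed to \<open>MOVES\<close>, so lists are
  never concatenated at run time. The \<open>let\<close> belongs to the logic: \<open>w\<close> and
  \<open>v\<close> are evaluated anew at each occurrence, at constant cost. \<open>RightE v\<close>
  is the predecessor of \<open>v\<close>, the index of its row.\<close>

definition extend_body :: expr where
  "extend_body =
     (let w = LeftE (Param 1); v = LeftE (RightE w) in
      IfPair (Param 1)
        (PairE (PairE (LeftE w) (PairE v (RightE w)))
          (Call MOVES [Call NTH [Param 0, RightE v], SucE AtomE, w,
             Call EXTEND [Param 0, RightE (Param 1)]]))
        AtomE)"

definition walks_body :: expr where
  "walks_body =
     IfPair (Param 1)
       (Call WALKS [Param 0, RightE (Param 1), Call EXTEND [Param 0, Param 2]])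
       (Param 2)"

definition eq_body :: expr where
  "eq_body =
     IfPair (Param 0)
       (IfPair (Param 1) (Call EQ [RightE (Param 0), RightE (Param 1)]) AtomE)
       (IfPair (Param 1) AtomE TrueE)"

text \<open>The recursive call \<open>ws\<close> is written twice but in exclusive branches, so each
  run makes it only once. The same holds for \<open>rest\<close> in
  \<open>compatible_body\<close>.\<close>

definition arrived_body :: expr where
  "arrived_body =
     (let w = LeftE (Param 0); ws = Call ARRIVED [RightE (Param 0)] in
      IfPair (Param 0)
        (IfPair (Call EQ [LeftE w, LeftE (RightE w)]) (PairE w ws) ws)
        AtomE)"

text \<open>Only the first list is tested for its end, so this decides \<open>compatible\<close> for
  nonempty lists of equal length.\<close>

definition compatible_body :: expr where
  "compatible_body =
     (let b = LeftE (Param 0); d = LeftE (Param 1);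
          a = LeftE (RightE (Param 0)); c = LeftE (RightE (Param 1));
          rest = Call COMPAT [RightE (Param 0), RightE (Param 1)] in
      IfPair (Call EQ [b, d]) AtomE
        (IfPair (RightE (Param 0))
          (IfPair (Call EQ [a, d])
            (IfPair (Call EQ [b, c]) rest AtomE)
            (IfPair (Call EQ [b, c]) AtomE rest))
          TrueE))"

definition row_body :: expr where
  "row_body =
     IfPair (Param 1)
       (PairE (Call COMPAT [RightE (Param 0), RightE (LeftE (Param 1))])
         (Call ROW [Param 0, RightE (Param 1)]))
       AtomE"

definition rows_body :: expr where
  "rows_body =
     IfPair (Param 0)
       (PairE (Call ROW [LeftE (Param 0), Param 1]) (Call ROWS [RightE (Param 0), Param 1]))
       AtomE"

definition length_body :: expr where
  "length_body = IfPair (Param 0) (SucE (Call LENGTH [RightE (Param 0)])) AtomE"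

definition prog :: program where
  "prog =
     [main_body, output_body, row_has_edge_body, has_edge_body, starts_body, nth_body, moves_body,
      extend_body, walks_body, eq_body, arrived_body, compatible_body, row_body, rows_body,
      length_body]"

lemma length_prog [simp]: "length prog = 15"
  by (simp add: prog_def)

text \<open>Not simplification rules: \<open>subst\<close> unfolds the one function under
  consideration, while the calls in its body stay folded and match the facts known about
  them.\<close>

lemma prog_nth:
  "prog ! 0 = main_body" "prog ! OUTPUT = output_body" "prog ! ROW_HAS_EDGE = row_has_edge_body"
  "prog ! HAS_EDGE = has_edge_body" "prog ! STARTS = starts_body" "prog ! NTH = nth_body"
  "prog ! MOVES = moves_body" "prog ! EXTEND = extend_body" "prog ! WALKS = walks_body"
  "prog ! EQ = eq_body" "prog ! ARRIVED = arrived_body" "prog ! COMPAT = compatible_body"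
  "prog ! ROW = row_body" "prog ! ROWS = rows_body" "prog ! LENGTH = length_body"
  by (simp_all add: prog_def)

section \<open>Results and running times of the functions\<close>

lemma encode_bool_eq_Atom [simp]: "encode_bool b = Atom \<longleftrightarrow> \<not> b"
  by (cases b) auto

lemma encode_list_eq_Atom [simp]: "encode_list enc xs = Atom \<longleftrightarrow> xs = []"
  by (cases xs) auto

lemma encode_nat_eq_Atom [simp]: "encode_nat i = Atom \<longleftrightarrow> i = 0"
  by (cases i) auto

lemma left_encode_list [simp]: "xs \<noteq> [] \<Longrightarrow> left (encode_list enc xs) = enc (hd xs)"
  by (cases xs) auto

lemma right_encode_list [simp]: "right (encode_list enc xs) = encode_list enc (tl xs)"
  by (cases xs) auto

lemma right_encode_nat [simp]: "right (encode_nat i) = encode_nat (i - 1)"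
  by (cases i) auto

lemma left_right_encode_walk [simp]:
  "left (encode_walk w) = encode_nat (fst w)"
  "right (encode_walk w) = encode_list encode_nat (snd w)"
  by (cases w; simp)+

lemma encode_walk_eq: "encode_walk w = Pair (encode_nat (fst w)) (encode_list encode_nat (snd w))"
  by (cases w) auto

text \<open>The pattern of all the following run lemmas: the simplifier executes the unfolded body,
  the induction hypothesis and earlier lemmas answer the calls, and linear arithmetic checks a
  generous time bound.\<close>

lemma row_has_edge_runs:
  "\<exists>t \<le> 12 * length r + 12.
     outcome prog [encode_list encode_bool r] (prog ! ROW_HAS_EDGE) =
       Some (encode_bool (True \<in> set r), t)"
proof (induction r)
  case Nil
  then show ?case
    by (subst prog_nth) (simp add: row_has_edge_body_def)
next
  case (Cons b r)
  then obtain t where "t \<le> 12 * length r + 12"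
    "outcome prog [encode_list encode_bool r] (prog ! ROW_HAS_EDGE) =
       Some (encode_bool (True \<in> set r), t)" by blast
  then show ?case
    by (subst prog_nth) (cases b; simp add: row_has_edge_body_def)
qed

lemma has_edge_runs:
  assumes "\<And>r. r \<in> set A \<Longrightarrow> length r \<le> n"
  shows "\<exists>t \<le> length A * (12 * n + 30) + 12.
     outcome prog [encode_list (encode_list encode_bool) A] (prog ! HAS_EDGE) =
       Some (encode_bool (\<exists>r \<in> set A. True \<in> set r), t)"
  using assms
proof (induction A)
  case Nil
  then show ?case
    by (subst prog_nth) (simp add: has_edge_body_def)
next
  case (Cons r A)
  then obtain t where "t \<le> length A * (12 * n + 30) + 12"
    "outcome prog [encode_list (encode_list encode_bool) A] (prog ! HAS_EDGE) =
       Some (encode_bool (\<exists>r \<in> set A. True \<in> set r), t)" by auto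
  moreover obtain s where "s \<le> 12 * length r + 12"
    "outcome prog [encode_list encode_bool r] (prog ! ROW_HAS_EDGE) =
       Some (encode_bool (True \<in> set r), s)" using row_has_edge_runs by blast
  moreover have "length r \<le> n" using Cons.prems by simp
  ultimately show ?case
    by (subst prog_nth) (cases "True \<in> set r"; simp add: has_edge_body_def)
qed

lemma starts_runs:
  "\<exists>t \<le> 20 * length gs + 12.
     outcome prog [encode_nat i, encode_list encode_nat gs] (prog ! STARTS) =
       Some (encode_list encode_walk (starts i gs), t)"
proof (induction gs arbitrary: i)
  case Nil
  then show ?case
    by (subst prog_nth) (simp add: starts_body_def)
next
  case (Cons g gs)
  obtain t where "t \<le> 20 * length gs + 12"
    "outcome prog [encode_nat (Suc i), encode_list encode_nat gs] (prog ! STARTS) =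
       Some (encode_list encode_walk (starts (Suc i) gs), t)" using Cons by blast
  then show ?case
    by (subst prog_nth) (simp add: starts_body_def)
qed

lemma nth_runs:
  assumes "i < length xs"
  shows "\<exists>t \<le> 10 * i + 10.
     outcome prog [encode_list enc xs, encode_nat i] (prog ! NTH) = Some (enc (xs ! i), t)"
  using assms
proof (induction i arbitrary: xs)
  case 0
  then show ?case
    by (subst prog_nth) (auto simp: nth_body_def hd_conv_nth)
next
  case (Suc i)
  then have len: "i < length (tl xs)" by simp
  obtain t where "t \<le> 10 * i + 10"
    "outcome prog [encode_list enc (tl xs), encode_nat i] (prog ! NTH) = Some (enc (tl xs ! i), t)"
    using Suc.IH[OF len] by blast
  then show ?case
    using len by (subst prog_nth) (simp add: nth_body_def nth_tl)
qed

lemma moves_runs: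
  "\<exists>t \<le> 30 * length r + 10.
     outcome prog [encode_list encode_bool r, encode_nat i, encode_walk w,
         encode_list encode_walk ws] (prog ! MOVES) =
       Some (encode_list encode_walk (moves r i w @ ws), t)"
proof (induction r arbitrary: i)
  case Nil
  then show ?case
    by (subst prog_nth) (simp add: moves_body_def)
next
  case (Cons b r)
  obtain t where "t \<le> 30 * length r + 10"
    "outcome prog [encode_list encode_bool r, encode_nat (Suc i), encode_walk w,
         encode_list encode_walk ws] (prog ! MOVES) =
       Some (encode_list encode_walk (moves r (Suc i) w @ ws), t)" using Cons by blast
  then show ?case
    by (subst prog_nth) (cases b; simp add: moves_body_def)
qed

text \<open>Per walk, \<open>NTH\<close> takes about \<open>10 * n\<close> and \<open>MOVES\<close>
  about \<open>30 * n\<close> steps. The condition on the heads keeps the row index inside the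
  matrix.\<close>

lemma extend_runs:
  assumes "length A = n" "\<And>r. r \<in> set A \<Longrightarrow> length r = n"
    and "\<And>w. w \<in> set ws \<Longrightarrow> snd w \<noteq> [] \<and> hd (snd w) \<in> {1..n}"
  shows "\<exists>t \<le> length ws * (40 * n + 60) + 10.
     outcome prog [encode_list (encode_list encode_bool) A, encode_list encode_walk ws]
         (prog ! EXTEND) =
       Some (encode_list encode_walk (extend A ws), t)"
  using assms(3)
proof (induction ws)
  case Nil
  then show ?case
    by (subst prog_nth) (simp add: extend_body_def Let_def)
next
  case (Cons w ws)
  let ?v = "hd (snd w)"
  have w: "snd w \<noteq> []" "?v - 1 < n" "?v - Suc 0 \<le> n" using Cons.prems[of w] by auto
  then have len: "length (A ! (?v - 1)) = n" using assms by simp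
  obtain t where "t \<le> length ws * (40 * n + 60) + 10"
    "outcome prog [encode_list (encode_list encode_bool) A, encode_list encode_walk ws]
         (prog ! EXTEND) =
       Some (encode_list encode_walk (extend A ws), t)" using Cons by auto
  moreover obtain s where "s \<le> 10 * (?v - 1) + 10"
    "outcome prog [encode_list (encode_list encode_bool) A, encode_nat (?v - 1)] (prog ! NTH) =
       Some (encode_list encode_bool (A ! (?v - 1)), s)"
    using nth_runs[of "?v - 1" A "encode_list encode_bool"] w assms(1) by blast
  moreover obtain u where "u \<le> 30 * length (A ! (?v - 1)) + 10"
    "outcome prog [encode_list encode_bool (A ! (?v - 1)), encode_nat 1, encode_walk w,
         encode_list encode_walk (extend A ws)] (prog ! MOVES) =
       Some (encode_list encode_walk (moves (A ! (?v - 1)) 1 w @ extend A ws), u)"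
    using moves_runs by blast
  ultimately show ?case
    using w len by (subst prog_nth) (simp add: extend_body_def Let_def encode_walk_eq[of "(_, _)"])
qed

lemma eq_runs:
  "\<exists>t \<le> 10 * a + 10.
     outcome prog [encode_nat a, encode_nat b] (prog ! EQ) = Some (encode_bool (a = b), t)"
proof (induction a arbitrary: b)
  case 0
  then show ?case
    by (subst prog_nth) (cases b; simp add: eq_body_def)
next
  case (Suc a)
  \<comment> \<open>The truncated \<open>b - 1\<close> is what the destructor yields on the encoding
    of \<open>b\<close>; the case \<open>b = 0\<close> is split off below.\<close>
  obtain t where "t \<le> 10 * a + 10"
    "outcome prog [encode_nat a, encode_nat (b - 1)] (prog ! EQ) =
       Some (encode_bool (a = b - 1), t)" using Suc by blast
  then show ?case
    by (subst prog_nth) (cases b; simp add: eq_body_def)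
qed

lemma arrived_runs:
  assumes "\<And>w. w \<in> set ws \<Longrightarrow> snd w \<noteq> [] \<and> fst w \<le> n"
  shows "\<exists>t \<le> length ws * (10 * n + 40) + 10.
     outcome prog [encode_list encode_walk ws] (prog ! ARRIVED) =
       Some (encode_list encode_walk (filter arrived ws), t)"
  using assms
proof (induction ws)
  case Nil
  then show ?case
    by (subst prog_nth) (simp add: arrived_body_def Let_def)
next
  case (Cons w ws)
  have w: "snd w \<noteq> []" "fst w \<le> n" using Cons.prems[of w] by auto
  obtain t where "t \<le> length ws * (10 * n + 40) + 10"
    "outcome prog [encode_list encode_walk ws] (prog ! ARRIVED) =
       Some (encode_list encode_walk (filter arrived ws), t)" using Cons by auto
  moreover obtain s where "s \<le> 10 * fst w + 10"
    "outcome prog [encode_nat (fst w), encode_nat (hd (snd w))] (prog ! EQ) =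
       Some (encode_bool (arrived w), s)" unfolding arrived_def using eq_runs by blast
  ultimately show ?case
    using w by (subst prog_nth) (cases "arrived w"; simp add: arrived_body_def Let_def)
qed

text \<open>Each position costs at most three calls of \<open>EQ\<close>. Their first argument,
  which governs the time, is always an entry of \<open>l\<close>, so bounding the entries of
  \<open>l\<close> suffices.\<close>

lemma compatible_runs:
  assumes "length l = length l'" "l \<noteq> []" "\<And>v. v \<in> set l \<Longrightarrow> v \<le> n"
  shows "\<exists>t \<le> length l * (30 * n + 100).
     outcome prog [encode_list encode_nat l, encode_list encode_nat l'] (prog ! COMPAT) =
       Some (encode_bool (compatible l l'), t)"
  using assms
proof (induction l l' rule: compatible.induct)
  case (1 b a l d c l')
  obtain t where "t \<le> length (a # l) * (30 * n + 100)"
    "outcome prog [encode_list encode_nat (a # l), encode_list encode_nat (c # l')]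
         (prog ! COMPAT) =
       Some (encode_bool (compatible (a # l) (c # l')), t)" using 1 by auto
  moreover obtain s1 where "s1 \<le> 10 * b + 10"
    "outcome prog [encode_nat b, encode_nat d] (prog ! EQ) = Some (encode_bool (b = d), s1)"
    using eq_runs by blast
  moreover obtain s2 where "s2 \<le> 10 * a + 10"
    "outcome prog [encode_nat a, encode_nat d] (prog ! EQ) = Some (encode_bool (a = d), s2)"
    using eq_runs by blast
  moreover obtain s3 where "s3 \<le> 10 * b + 10"
    "outcome prog [encode_nat b, encode_nat c] (prog ! EQ) = Some (encode_bool (b = c), s3)"
    using eq_runs by blast
  moreover have "a \<le> n" "b \<le> n" using "1.prems" by auto
  ultimately show ?case
    by (subst prog_nth)
      (cases "b = d"; cases "a = d"; cases "b = c"; simp add: compatible_body_def Let_def)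
next
  case (2 b d)
  obtain s where "s \<le> 10 * b + 10"
    "outcome prog [encode_nat b, encode_nat d] (prog ! EQ) = Some (encode_bool (b = d), s)"
    using eq_runs by blast
  then show ?case
    using "2.prems"(3)[of b] by (subst prog_nth) (cases "b = d"; simp add: compatible_body_def Let_def)
qed auto

lemma row_runs:
  assumes "length (snd w) = q" "q > 0" "\<And>v. v \<in> set (snd w) \<Longrightarrow> v \<le> n"
    and "\<And>w. w \<in> set ws \<Longrightarrow> length (snd w) = q"
  shows "\<exists>t \<le> length ws * (q * (30 * n + 100) + 20) + 10.
     outcome prog [encode_walk w, encode_list encode_walk ws] (prog ! ROW) =
       Some (encode_list encode_bool (map (\<lambda>w'. compatible (snd w) (snd w')) ws), t)"
  using assms(4)
proof (induction ws)
  case Nil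
  then show ?case
    by (subst prog_nth) (simp add: row_body_def)
next
  case (Cons w' ws)
  obtain t where "t \<le> length ws * (q * (30 * n + 100) + 20) + 10"
    "outcome prog [encode_walk w, encode_list encode_walk ws] (prog ! ROW) =
       Some (encode_list encode_bool (map (\<lambda>w'. compatible (snd w) (snd w')) ws), t)"
    using Cons.IH Cons.prems by (meson list.set_intros(2))
  moreover obtain s where "s \<le> length (snd w) * (30 * n + 100)"
    "outcome prog [encode_list encode_nat (snd w), encode_list encode_nat (snd w')]
         (prog ! COMPAT) =
       Some (encode_bool (compatible (snd w) (snd w')), s)"
    proof -
    have "length (snd w) = length (snd w')" "snd w \<noteq> []" using assms Cons.prems by auto
    from compatible_runs[OF this assms(3)] show ?thesis using that by blast
  qed
  ultimately show ?case
    using assms(1) by (subst prog_nth) (simp add: row_body_def)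
qed

text \<open>The induction consumes the list \<open>ws\<close> of rows still to be written, while
  \<open>ws'\<close> supplies the columns of every row and stays fixed.\<close>

lemma rows_runs:
  assumes "q > 0"
    and "\<And>w. w \<in> set ws' \<Longrightarrow> length (snd w) = q \<and> (\<forall>v \<in> set (snd w). v \<le> n)"
    and "set ws \<subseteq> set ws'"
  shows "\<exists>t \<le> length ws * (length ws' * (q * (30 * n + 100) + 20) + 30) + 10.
     outcome prog [encode_list encode_walk ws, encode_list encode_walk ws'] (prog ! ROWS) =
       Some (encode_list (encode_list encode_bool)
         (map (\<lambda>w. map (\<lambda>w'. compatible (snd w) (snd w')) ws') ws), t)"
  using assms(3)
proof (induction ws)
  case Nil
  then show ?case
    by (subst prog_nth) (simp add: rows_body_def)
next
  case (Cons w ws)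
  obtain t where "t \<le> length ws * (length ws' * (q * (30 * n + 100) + 20) + 30) + 10"
    "outcome prog [encode_list encode_walk ws, encode_list encode_walk ws'] (prog ! ROWS) =
       Some (encode_list (encode_list encode_bool)
         (map (\<lambda>w. map (\<lambda>w'. compatible (snd w) (snd w')) ws') ws), t)"
    using Cons by auto
  moreover obtain s where "s \<le> length ws' * (q * (30 * n + 100) + 20) + 10"
    "outcome prog [encode_walk w, encode_list encode_walk ws'] (prog ! ROW) =
       Some (encode_list encode_bool (map (\<lambda>w'. compatible (snd w) (snd w')) ws'), s)"
    proof -
    have "w \<in> set ws'" using Cons.prems by simp
    then show ?thesis using row_runs[of w q n ws'] assms(1,2) that by blast
  qed
  ultimately show ?case
    by (subst prog_nth) (simp add: rows_body_def)
qed

lemma length_runs: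
  "\<exists>t \<le> 10 * length xs + 10.
     outcome prog [encode_list enc xs] (prog ! LENGTH) = Some (encode_nat (length xs), t)"
proof (induction xs)
  case Nil
  then show ?case
    by (subst prog_nth) (simp add: length_body_def)
next
  case (Cons x xs)
  then obtain t where "t \<le> 10 * length xs + 10"
    "outcome prog [encode_list enc xs] (prog ! LENGTH) = Some (encode_nat (length xs), t)" by blast
  then show ?case
    by (subst prog_nth) (simp add: length_body_def)
qed

section \<open>Lazy walks\<close>

text \<open>A walk of \<open>k\<close> steps lists \<open>k + 1\<close> vertices, so the empty list
  is no walk. The head is the end of the walk and the last entry its start.\<close>

fun lazy_walk :: "nat \<Rightarrow> nat set set \<Rightarrow> nat list \<Rightarrow> bool" where
  "lazy_walk n E [] \<longleftrightarrow> False"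
| "lazy_walk n E [v] \<longleftrightarrow> v \<in> {1..n}"
| "lazy_walk n E (u # v # l) \<longleftrightarrow>
     u \<in> {1..n} \<and> (u = v \<or> {v, u} \<in> E) \<and> lazy_walk n E (v # l)"

definition walks :: "nat \<Rightarrow> nat set set \<Rightarrow> (nat \<Rightarrow> nat) \<Rightarrow> nat \<Rightarrow> (nat \<times> nat list) list" where
  "walks n E \<pi> k = (extend (adjacency_matrix n E) ^^ k) (starts 1 (map \<pi> [1..<Suc n]))"

lemma lazy_walk_not_Nil: "lazy_walk n E l \<Longrightarrow> l \<noteq> []"
  by auto

lemma lazy_walk_subset: "lazy_walk n E l \<Longrightarrow> set l \<subseteq> {1..n}"
  by (induction n E l rule: lazy_walk.induct) auto

lemma lazy_walk_Cons:
  "l \<noteq> [] \<Longrightarrow> lazy_walk n E (v # l) \<longleftrightarrow>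
     v \<in> {1..n} \<and> (v = hd l \<or> {hd l, v} \<in> E) \<and> lazy_walk n E l"
  by (cases l) auto

text \<open>Induction on the length of the interval, because its lower end moves up with each
  entry.\<close>

lemma starts_map_upt: "starts i (map f [i..<j]) = map (\<lambda>v. (f v, [v])) [i..<j]"
proof (induction "j - i" arbitrary: i)
  case (Suc d)
  then have "i < j" by simp
  with Suc show ?case by (simp add: upt_conv_Cons)
qed simp

lemma moves_map_upt:
  "moves (map p [i..<j]) i w = map (\<lambda>v. (fst w, v # snd w)) (filter p [i..<j])"
proof (induction "j - i" arbitrary: i)
  case (Suc d)
  then have "i < j" by simp
  with Suc show ?case by (simp add: upt_conv_Cons)
qed simp

lemma adjacency_matrix_dims:
  "length (adjacency_matrix n E) = n"
  "r \<in> set (adjacency_matrix n E) \<Longrightarrow> length r = n"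
  by (auto simp: adjacency_matrix_def simp del: upt_Suc)

lemma adjacency_matrix_nth:
  assumes "v \<in> {1..n}"
  shows "adjacency_matrix n E ! (v - 1) = map (\<lambda>u. {v, u} \<in> E) [1..<Suc n]"
proof -
  have "v - 1 < length [1..<Suc n]" "[1..<Suc n] ! (v - 1) = v"
    using assms by (auto simp del: upt_Suc)
  then show ?thesis
    unfolding adjacency_matrix_def by (subst nth_map) simp_all
qed

lemma adjacency_matrix_has_edge:
  assumes "simple_graph n E"
  shows "(\<exists>r \<in> set (adjacency_matrix n E). True \<in> set r) \<longleftrightarrow> E \<noteq> {}"
proof
  assume "E \<noteq> {}"
  then obtain e where "e \<in> E" by auto
  moreover from this assms obtain u v where "e = {u, v}"
    by (auto simp: simple_graph_def card_2_iff)
  moreover have "e \<subseteq> {1..n}" using assms \<open>e \<in> E\<close> by (auto simp: simple_graph_def)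
  ultimately have "u \<in> set [1..<Suc n]" "v \<in> set [1..<Suc n]" "{u, v} \<in> E"
    by auto
  then show "\<exists>r \<in> set (adjacency_matrix n E). True \<in> set r"
    unfolding adjacency_matrix_def set_map by (force simp del: upt_Suc)
qed (auto simp: adjacency_matrix_def)

text \<open>The map from \<open>u\<close> to \<open>{v, u}\<close> injects the neighbours of
  \<open>v\<close> into the edges at \<open>v\<close>.\<close>

lemma card_neighbours_le:
  assumes "simple_graph n E" "v \<in> {1..n}"
  shows "card {u \<in> {1..n}. {v, u} \<in> E} \<le> max_degree n E"
proof -
  have "E \<subseteq> Pow {1..n}"
    using assms(1) by (auto simp: simple_graph_def)
  then have "finite E"
    by (rule finite_subset) simp
  then have "card {u \<in> {1..n}. {v, u} \<in> E} \<le> degree E v"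
    unfolding degree_def
    by (intro card_inj_on_le[where f = "\<lambda>u. {v, u}"]) (auto simp: inj_on_def doubleton_eq_iff)
  also have "\<dots> \<le> max_degree n E"
    unfolding max_degree_def using assms(2) by (intro Max_ge) auto
  finally show ?thesis .
qed

lemma set_extend:
  assumes "\<And>w. w \<in> set ws \<Longrightarrow> hd (snd w) \<in> {1..n}"
  shows "set (extend (adjacency_matrix n E) ws) =
    {(fst w, v # snd w) | w v. w \<in> set ws \<and> v \<in> {1..n} \<and>
       (v = hd (snd w) \<or> {hd (snd w), v} \<in> E)}"
  using assms
proof (induction ws)
  case (Cons w ws)
  have "hd (snd w) \<in> {1..n}" using Cons.prems by simp
  then have "set (moves (adjacency_matrix n E ! (hd (snd w) - 1)) 1 w) =
    {(fst w, v # snd w) | v. v \<in> {1..n} \<and> {hd (snd w), v} \<in> E}"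
    unfolding adjacency_matrix_nth[OF \<open>hd (snd w) \<in> {1..n}\<close>] moves_map_upt
    by (auto simp del: upt_Suc)
  moreover have "set (extend (adjacency_matrix n E) ws) =
    {(fst w, v # snd w) | w v. w \<in> set ws \<and> v \<in> {1..n} \<and>
       (v = hd (snd w) \<or> {hd (snd w), v} \<in> E)}"
    by (rule Cons.IH) (rule Cons.prems, simp)
  moreover note \<open>hd (snd w) \<in> {1..n}\<close>
  ultimately show ?case by auto
qed simp

text \<open>Every walk is continued once by waiting and at most \<Delta> times by moving.\<close>

lemma length_extend_le:
  assumes "simple_graph n E" "\<And>w. w \<in> set ws \<Longrightarrow> hd (snd w) \<in> {1..n}"
  shows "length (extend (adjacency_matrix n E) ws) \<le> length ws * (max_degree n E + 1)"
  using assms(2)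
proof (induction ws)
  case (Cons w ws)
  have v: "hd (snd w) \<in> {1..n}" using Cons.prems by simp
  have "length (moves (adjacency_matrix n E ! (hd (snd w) - 1)) 1 w) =
      card (set (filter (\<lambda>u. {hd (snd w), u} \<in> E) [1..<Suc n]))"
    unfolding adjacency_matrix_nth[OF v] moves_map_upt
    by (subst distinct_card) (auto simp del: upt_Suc)
  also have "\<dots> = card {u \<in> {1..n}. {hd (snd w), u} \<in> E}"
    by (rule arg_cong[where f = card]) auto
  also have "\<dots> \<le> max_degree n E" using card_neighbours_le[OF assms(1) v] .
  finally show ?case using Cons by simp
qed simp

text \<open>Extension puts a vertex in front, so it changes neither the last entry, which is the
  start, nor the target attached to it.\<close>

lemma set_walks:
  "set (walks n E \<pi> k) = {(\<pi> (last l), l) | l. lazy_walk n E l \<and> length l = Suc k}"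
proof (induction k)
  case 0
  have "set (walks n E \<pi> 0) = {(\<pi> v, [v]) | v. v \<in> {1..n}}"
    unfolding walks_def funpow_0 starts_map_upt by auto
  also have "\<dots> = {(\<pi> (last l), l) | l. lazy_walk n E l \<and> length l = Suc 0}"
    by (force simp: length_Suc_conv)
  finally show ?case .
next
  case (Suc k)
  have hd: "hd (snd w) \<in> {1..n}" if "w \<in> set (walks n E \<pi> k)" for w
  proof -
    from that Suc obtain l where "w = (\<pi> (last l), l)" "lazy_walk n E l" by auto
    then show ?thesis using lazy_walk_subset lazy_walk_not_Nil by fastforce
  qed
  have "walks n E \<pi> (Suc k) = extend (adjacency_matrix n E) (walks n E \<pi> k)"
    by (simp add: walks_def)
  then have "set (walks n E \<pi> (Suc k)) = {(fst w, v # snd w) | w v. w \<in> set (walks n E \<pi> k) \<and>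
      v \<in> {1..n} \<and> (v = hd (snd w) \<or> {hd (snd w), v} \<in> E)}"
    using set_extend[OF hd] by simp
  also have "\<dots> = {(\<pi> (last l), v # l) | l v. lazy_walk n E l \<and> length l = Suc k \<and>
      v \<in> {1..n} \<and> (v = hd l \<or> {hd l, v} \<in> E)}"
    unfolding Suc by fastforce
  also have "\<dots> = {(\<pi> (last l), l) | l. lazy_walk n E l \<and> length l = Suc (Suc k)}"
    (is "?L = ?R")
  proof
    show "?L \<subseteq> ?R"
    proof
      fix x assume "x \<in> ?L"
      then obtain l v where "x = (\<pi> (last l), v # l)" "lazy_walk n E l" "length l = Suc k"
        "v \<in> {1..n}" "v = hd l \<or> {hd l, v} \<in> E" by auto
      moreover from this have "l \<noteq> []" by auto
      ultimately show "x \<in> ?R"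
        by (auto simp: lazy_walk_Cons intro!: exI[of _ "v # l"])
    qed
    show "?R \<subseteq> ?L"
    proof
      fix x assume "x \<in> ?R"
      then obtain l where l: "x = (\<pi> (last l), l)" "lazy_walk n E l" "length l = Suc (Suc k)"
        by auto
      then obtain v l' where "l = v # l'" "l' \<noteq> []"
        by (metis length_0_conv length_Suc_conv nat.distinct(1))
      with l show "x \<in> ?L"
        by (auto simp: lazy_walk_Cons)
    qed
  qed
  finally show ?case .
qed

lemma walks_snd:
  assumes "w \<in> set (walks n E \<pi> k)"
  shows "lazy_walk n E (snd w)" "length (snd w) = Suc k" "fst w = \<pi> (last (snd w))"
    and "snd w \<noteq> []" "hd (snd w) \<in> {1..n}"
proof -
  show l: "lazy_walk n E (snd w)" "length (snd w) = Suc k" "fst w = \<pi> (last (snd w))"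
    using assms by (auto simp: set_walks)
  show "snd w \<noteq> []"
    using l(1) by (rule lazy_walk_not_Nil)
  then show "hd (snd w) \<in> {1..n}"
    using lazy_walk_subset[OF l(1)] hd_in_set by blast
qed

lemma length_walks_le:
  assumes "simple_graph n E"
  shows "length (walks n E \<pi> k) \<le> n * (max_degree n E + 1) ^ k"
proof (induction k)
  case 0
  show ?case unfolding walks_def funpow_0 starts_map_upt by simp
next
  case (Suc k)
  have "length (walks n E \<pi> (Suc k)) \<le> length (walks n E \<pi> k) * (max_degree n E + 1)"
    using length_extend_le[OF assms walks_snd(5)] by (simp add: walks_def)
  also have "\<dots> \<le> n * (max_degree n E + 1) ^ k * (max_degree n E + 1)"
    using Suc by (intro mult_right_mono) auto
  finally show ?case by (simp add: algebra_simps)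
qed

section \<open>The graph of compatible walks\<close>

lemma compatible_Cons:
  "length l = length l' \<Longrightarrow> l \<noteq> [] \<Longrightarrow> compatible (v # l) (v' # l') \<longleftrightarrow>
     v \<noteq> v' \<and> (hd l = v' \<longleftrightarrow> v = hd l') \<and> compatible l l'"
  by (cases l; cases l') auto

text \<open>A walk shares its end with itself. Hence the walk graph has no loops, and two list
  positions holding the same walk would not be adjacent. The borrowed case rule separates empty,
  singleton and longer lists.\<close>

lemma compatible_irrefl: "\<not> compatible l l"
  by (cases l rule: remdups_adj.cases) auto

lemma compatible_sym: "compatible l l' \<Longrightarrow> compatible l' l"
  by (induction l l' rule: compatible.induct) auto

lemma compatible_hd: "compatible l l' \<Longrightarrow> hd l \<noteq> hd l'"
  by (cases "(l, l')" rule: compatible.cases) auto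

text \<open>As the last entry is the starting vertex, compatible walks belong to different pebbles;
  counting the walks of a clique thus counts pebbles.\<close>

lemma compatible_last: "compatible l l' \<Longrightarrow> last l \<noteq> last l'"
  by (induction l l' rule: compatible.induct) auto

text \<open>Vertices are numbered from 1, list positions from 0.\<close>

definition walk_graph :: "(nat \<times> nat list) list \<Rightarrow> nat set set" where
  "walk_graph ws =
     {{u, v} | u v. u \<in> {1..length ws} \<and> v \<in> {1..length ws} \<and>
        compatible (snd (ws ! (u - 1))) (snd (ws ! (v - 1)))}"

lemma simple_walk_graph: "simple_graph (length ws) (walk_graph ws)"
  by (auto simp: simple_graph_def walk_graph_def card_2_iff) (metis compatible_irrefl)

text \<open>The pair witnessing an edge may come in either order, which the symmetry of
  \<open>compatible\<close> absorbs.\<close>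

lemma walk_graph_iff:
  assumes "u \<in> {1..length ws}" "v \<in> {1..length ws}"
  shows "{u, v} \<in> walk_graph ws \<longleftrightarrow> compatible (snd (ws ! (u - 1))) (snd (ws ! (v - 1)))"
proof
  assume "{u, v} \<in> walk_graph ws"
  then obtain x y where "{u, v} = {x, y}" "compatible (snd (ws ! (x - 1))) (snd (ws ! (y - 1)))"
    unfolding walk_graph_def by blast
  then show "compatible (snd (ws ! (u - 1))) (snd (ws ! (v - 1)))"
    using compatible_sym by (metis doubleton_eq_iff)
next
  assume "compatible (snd (ws ! (u - 1))) (snd (ws ! (v - 1)))"
  with assms show "{u, v} \<in> walk_graph ws"
    unfolding walk_graph_def by blast
qed

text \<open>Identifies the output of \<open>ROWS\<close>: both maps over the list are reindexed by
  vertex numbers.\<close>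

lemma adjacency_matrix_walk_graph:
  "adjacency_matrix (length ws) (walk_graph ws) =
     map (\<lambda>w. map (\<lambda>w'. compatible (snd w) (snd w')) ws) ws"
proof -
  have eq: "map f ws = map (\<lambda>u. f (ws ! (u - 1))) [1..<Suc (length ws)]" for f :: "_ \<Rightarrow> 'c"
    by (rule nth_equalityI) (auto simp del: upt_Suc)
  show ?thesis
    unfolding adjacency_matrix_def
    by (subst (1 2) eq) (auto simp: walk_graph_iff simp del: upt_Suc One_nat_def)
qed

section \<open>Cliques and routings\<close>

lemma matching_eq_or_disjnt:
  "matching E M \<Longrightarrow> e \<in> M \<Longrightarrow> f \<in> M \<Longrightarrow> e \<inter> f \<noteq> {} \<Longrightarrow> e = f"
  by (auto simp: matching_def pairwise_def disjnt_def)

text \<open>Two edges of a matching that share \<open>a\<close> are equal, so the partner of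
  \<open>a\<close> is unique and the definite description denotes it.\<close>

lemma swap_along_edge:
  assumes "matching E M" "{a, b} \<in> M"
  shows "swap_along M a = b"
proof -
  have "y = b" if "{a, y} \<in> M" for y
    using matching_eq_or_disjnt[OF assms that] assms(2) by (auto simp: doubleton_eq_iff)
  then have "(THE y. {a, y} \<in> M) = b"
    using assms(2) by blast
  then show ?thesis
    using assms(2) by (auto simp: swap_along_def)
qed

lemma swap_along_cases:
  assumes "simple_graph n E" "matching E M"
  obtains "swap_along M a = a" "\<And>y. {a, y} \<notin> M"
  | "{a, swap_along M a} \<in> M" "swap_along M a \<noteq> a"
proof (cases "\<exists>y. {a, y} \<in> M")
  case True
  then obtain y where y: "{a, y} \<in> M" by blast
  then have "{a, y} \<in> E" using assms(2) by (auto simp: matching_def)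
  then have "y \<noteq> a" using assms(1) by (auto simp: simple_graph_def)
  then show ?thesis
    using that(2) y unfolding swap_along_edge[OF assms(2) y] by blast
next
  case False
  then have "swap_along M a = a" by (simp add: swap_along_def)
  then show ?thesis using that(1) False by blast
qed

lemma swap_along_involution:
  assumes "simple_graph n E" "matching E M"
  shows "swap_along M (swap_along M a) = a"
proof (rule swap_along_cases[OF assms, of a])
  assume "{a, swap_along M a} \<in> M"
  then have "{swap_along M a, a} \<in> M" by (simp add: insert_commute)
  then show ?thesis by (rule swap_along_edge[OF assms(2)])
qed simp

text \<open>An involution is its own inverse, and all matched edges lie inside
  \<open>{1..n}\<close>.\<close>

lemma swap_along_permutes:
  assumes "simple_graph n E" "matching E M"
  shows "swap_along M permutes {1..n}"
proof (rule bij_imp_permutes)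
  show "bij_betw (swap_along M) {1..n} {1..n}"
  proof (rule bij_betw_byWitness[where f' = "swap_along M"])
    show "swap_along M ` {1..n} \<subseteq> {1..n}"
    proof
      fix y assume "y \<in> swap_along M ` {1..n}"
      then obtain x where x: "x \<in> {1..n}" "y = swap_along M x" by auto
      show "y \<in> {1..n}"
      proof (rule swap_along_cases[OF assms, of x])
        assume "{x, swap_along M x} \<in> M"
        then have "{x, y} \<in> E" using assms(2) x by (auto simp: matching_def)
        with assms(1) show ?thesis by (auto simp: simple_graph_def)
      qed (use x in auto)
    qed
    then show "swap_along M ` {1..n} \<subseteq> {1..n}" .
  qed (simp_all add: swap_along_involution[OF assms])
  show "swap_along M x = x" if "x \<notin> {1..n}" for x
  proof (rule swap_along_cases[OF assms, of x])
    assume "{x, swap_along M x} \<in> M"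
    then have "{x, swap_along M x} \<in> E" using assms(2) by (auto simp: matching_def)
    with assms(1) that show ?thesis by (auto simp: simple_graph_def)
  qed
qed

lemma position_snoc: "position (Ms @ [M]) v = swap_along M (position Ms v)"
  by (simp add: position_def)

lemma position_permutes:
  assumes "simple_graph n E" "\<forall>M \<in> set Ms. matching E M"
  shows "position Ms permutes {1..n}"
  using assms(2)
proof (induction Ms rule: rev_induct)
  case Nil
  show ?case by (simp add: position_def[abs_def] permutes_id[unfolded id_def])
next
  case (snoc M Ms)
  have "position (Ms @ [M]) = swap_along M \<circ> position Ms"
    by (auto simp: position_snoc)
  with snoc swap_along_permutes[OF assms(1), of M] show ?case
    by (simp add: permutes_compose del: comp_apply)
qed

text \<open>A finite infimum of extended naturals is attained, and a shorter routing is padded to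
  length exactly \<open>k\<close> with empty matchings, which move nothing.\<close>

lemma rt_le_iff:
  "rt n E \<sigma> \<le> enat k \<longleftrightarrow>
     (\<exists>Ms. (\<forall>M \<in> set Ms. matching E M) \<and> (\<forall>v \<in> {1..n}. position Ms v = \<sigma> v) \<and> length Ms = k)"
proof
  let ?S = "{Ms. (\<forall>M\<in>set Ms. matching E M) \<and> (\<forall>v\<in>{1..n}. position Ms v = \<sigma> v)}"
  assume le: "rt n E \<sigma> \<le> enat k"
  have "?S \<noteq> {}"
  proof
    assume empty: "?S = {}"
    show False using le unfolding rt_def empty by (simp add: top_enat_def)
  qed
  then obtain Ms where "Ms \<in> ?S" by blast
  then have "enat (length Ms) \<in> (\<lambda>Ms. enat (length Ms)) ` ?S" by (rule imageI)
  then have "rt n E \<sigma> \<in> (\<lambda>Ms. enat (length Ms)) ` ?S"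
    unfolding rt_def by (rule wellorder_InfI)
  then obtain Ms where Ms: "Ms \<in> ?S" "rt n E \<sigma> = enat (length Ms)" by (rule imageE)
  then have "length Ms \<le> k" using le by simp
  have "matching E {}" by (simp add: matching_def)
  moreover have "fold swap_along (replicate i {}) v = v" for i v
    by (induction i) (auto simp: swap_along_def)
  ultimately show "\<exists>Ms. (\<forall>M \<in> set Ms. matching E M) \<and> (\<forall>v \<in> {1..n}. position Ms v = \<sigma> v) \<and>
      length Ms = k"
    using Ms(1) \<open>length Ms \<le> k\<close>
    by (intro exI[of _ "Ms @ replicate (k - length Ms) {}"]) (auto simp: position_def)
next
  assume "\<exists>Ms. (\<forall>M \<in> set Ms. matching E M) \<and> (\<forall>v \<in> {1..n}. position Ms v = \<sigma> v) \<and>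
      length Ms = k"
  then obtain Ms where
    "Ms \<in> {Ms. (\<forall>M\<in>set Ms. matching E M) \<and> (\<forall>v\<in>{1..n}. position Ms v = \<sigma> v)}"
    "length Ms = k" by blast
  then show "rt n E \<sigma> \<le> enat k" unfolding rt_def by (metis (no_types, lifting) INF_lower)
qed

text \<open>The permutation \<tau> is \<open>\<sigma> \<circ> inv \<pi>\<close>, and \<pi> maps the
  points where \<sigma> and \<pi> agree bijectively onto its fixed points.\<close>

lemma perm_agreement_eq:
  assumes "\<pi> permutes {1..n}" "\<sigma> permutes {1..n}"
  shows "perm_agreement n \<pi> \<sigma> = card {v \<in> {1..n}. \<sigma> v = \<pi> v}"
proof -
  have the: "(THE \<tau>. \<tau> permutes {1..n} \<and> \<tau> \<circ> \<pi> = \<sigma>) = \<sigma> \<circ> inv \<pi>"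
  proof (rule the_equality)
    show "\<sigma> \<circ> inv \<pi> permutes {1..n} \<and> \<sigma> \<circ> inv \<pi> \<circ> \<pi> = \<sigma>"
      using assms by (auto simp: permutes_compose permutes_inv permutes_inv_o comp_assoc)
    show "\<tau> = \<sigma> \<circ> inv \<pi>" if "\<tau> permutes {1..n} \<and> \<tau> \<circ> \<pi> = \<sigma>" for \<tau>
      using assms that by (auto simp: comp_assoc permutes_inv_o)
  qed
  have "bij_betw \<pi> {v \<in> {1..n}. \<sigma> v = \<pi> v} {i \<in> {1..n}. (\<sigma> \<circ> inv \<pi>) i = i}"
  proof (rule bij_betw_subset[where A = UNIV])
    show "bij_betw \<pi> UNIV UNIV" using assms(1) by (simp add: permutes_bij)
    show "\<pi> ` {v \<in> {1..n}. \<sigma> v = \<pi> v} = {i \<in> {1..n}. (\<sigma> \<circ> inv \<pi>) i = i}"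
    proof (intro equalityI subsetI)
      fix i assume i: "i \<in> {i \<in> {1..n}. (\<sigma> \<circ> inv \<pi>) i = i}"
      then have "inv \<pi> i \<in> {1..n}" "\<pi> (inv \<pi> i) = i"
        using permutes_in_image[OF permutes_inv[OF assms(1)]] permutes_inverses(1)[OF assms(1)]
        by auto
      with i show "i \<in> \<pi> ` {v \<in> {1..n}. \<sigma> v = \<pi> v}"
        by (intro image_eqI[of _ _ "inv \<pi> i"]) auto
    next
      fix i assume "i \<in> \<pi> ` {v \<in> {1..n}. \<sigma> v = \<pi> v}"
      then show "i \<in> {i \<in> {1..n}. (\<sigma> \<circ> inv \<pi>) i = i}"
        using permutes_in_image[OF assms(1)] permutes_inverses(2)[OF assms(1)] by auto
    qed
  qed simp
  then show ?thesis
    unfolding perm_agreement_def Let_def the by (simp add: bij_betw_same_card)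
qed

text \<open>Induction on \<open>k\<close>, removing the final step, which is the head of each list.
  The tails are routed by the induction hypothesis, and the edges used in the final step form the
  one matching that is added.\<close>

lemma compatible_family_routing:
  assumes "simple_graph n E"
    and "\<And>l. l \<in> L \<Longrightarrow> lazy_walk n E l \<and> length l = Suc k"
    and "\<And>l l'. l \<in> L \<Longrightarrow> l' \<in> L \<Longrightarrow> l \<noteq> l' \<Longrightarrow> compatible l l'"
  shows "\<exists>Ms. length Ms = k \<and> (\<forall>M \<in> set Ms. matching E M) \<and>
    (\<forall>l \<in> L. position Ms (last l) = hd l)"
  using assms(2,3)
proof (induction k arbitrary: L)
  case 0
  have "last l = hd l" if "l \<in> L" for l
    using 0(1)[OF that] by (cases l) auto
  then show ?case by (auto simp: position_def)
next
  case (Suc k)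
  have tl: "tl l \<noteq> []" "l = hd l # tl l" if "l \<in> L" for l
    using Suc.prems(1)[OF that] by (auto simp: length_Suc_conv)
  have compatible: "hd l \<noteq> hd l' \<and> (hd (tl l) = hd l' \<longleftrightarrow> hd l = hd (tl l')) \<and>
      compatible (tl l) (tl l')" if "l \<in> L" "l' \<in> L" "l \<noteq> l'" for l l'
  proof -
    have "length (tl l) = length (tl l')"
      using Suc.prems(1)[OF that(1)] Suc.prems(1)[OF that(2)] by simp
    from compatible_Cons[OF this tl(1)[OF that(1)], of "hd l" "hd l'"] Suc.prems(2)[OF that]
    show ?thesis
      unfolding tl(2)[OF that(1), symmetric] tl(2)[OF that(2), symmetric] by blast
  qed
  have walk: "lazy_walk n E (tl l)" "hd l = hd (tl l) \<or> {hd (tl l), hd l} \<in> E"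
    if "l \<in> L" for l
    using Suc.prems(1)[OF that] lazy_walk_Cons[OF tl(1)[OF that], of n E "hd l"]
    unfolding tl(2)[OF that, symmetric] by blast+
  have "\<exists>Ms. length Ms = k \<and> (\<forall>M \<in> set Ms. matching E M) \<and>
      (\<forall>l \<in> tl ` L. position Ms (last l) = hd l)"
  proof (rule Suc.IH)
    show "lazy_walk n E l \<and> length l = Suc k" if "l \<in> tl ` L" for l
      using that walk(1) Suc.prems(1) by auto
    show "compatible l l'" if "l \<in> tl ` L" "l' \<in> tl ` L" "l \<noteq> l'" for l l'
      using that compatible by blast
  qed
  then obtain Ms where Ms: "length Ms = k" "\<forall>M \<in> set Ms. matching E M"
    "\<And>l. l \<in> L \<Longrightarrow> position Ms (last (tl l)) = hd (tl l)" by auto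
  define M where "M = {{hd (tl l), hd l} | l. l \<in> L \<and> hd l \<noteq> hd (tl l)}"
  \<comment> \<open>The tails are compatible too, so distinct walks stand on distinct vertices
    before the final step.\<close>
  have compatible_hd_tl: "hd (tl l) \<noteq> hd (tl l')" if "l \<in> L" "l' \<in> L" "l \<noteq> l'" for l l'
    using compatible[OF that] compatible_hd by blast
  have match: "matching E M"
    unfolding matching_def
  proof
    show "M \<subseteq> E"
    proof
      fix e assume "e \<in> M"
      then obtain l where "l \<in> L" "hd l \<noteq> hd (tl l)" "e = {hd (tl l), hd l}"
        unfolding M_def by blast
      with walk(2)[of l] show "e \<in> E" by simp
    qed
    show "pairwise disjnt M"
    proof (rule pairwiseI)
      fix e f assume "e \<in> M" "f \<in> M" "e \<noteq> f"
      then obtain l l' where l: "l \<in> L" "l' \<in> L"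
        and ef: "e = {hd (tl l), hd l}" "f = {hd (tl l'), hd l'}"
        unfolding M_def by blast
      have "l \<noteq> l'" using ef \<open>e \<noteq> f\<close> by metis
      note facts = compatible[OF l this] compatible_hd_tl[OF l this]
      \<comment> \<open>Were one walk to start the step where the other ends it, the two would swap
        and use the same edge.\<close>
      have "hd (tl l) \<noteq> hd l'"
      proof
        assume "hd (tl l) = hd l'"
        with facts ef have "e = f" by (simp add: insert_commute)
        with \<open>e \<noteq> f\<close> show False by contradiction
      qed
      with facts show "disjnt e f" by (simp add: ef disjnt_def)
    qed
  qed
  have "swap_along M (hd (tl l)) = hd l" if l: "l \<in> L" for l
  proof (rule swap_along_cases[OF assms(1) match, of "hd (tl l)"])
    assume fixed: "swap_along M (hd (tl l)) = hd (tl l)" and "\<And>y. {hd (tl l), y} \<notin> M"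
    then have "\<not> (hd l \<noteq> hd (tl l))" using l unfolding M_def by blast
    with fixed show ?thesis by simp
  next
    assume "{hd (tl l), swap_along M (hd (tl l))} \<in> M"
    then obtain l' where l': "l' \<in> L" "hd l' \<noteq> hd (tl l')"
      and eq: "{hd (tl l), swap_along M (hd (tl l))} = {hd (tl l'), hd l'}"
      unfolding M_def by auto
    show ?thesis
    proof (cases "l = l'")
      case True
      with eq show ?thesis by (auto simp: doubleton_eq_iff)
    next
      case False
      \<comment> \<open>The two walks start the step at different vertices, so \<open>l\<close>
        starts it where \<open>l'\<close> ends it. By compatibility \<open>l\<close> then ends it
        where \<open>l'\<close> starts it, at the other end of the matched edge.\<close>
      with eq compatible[OF l l'(1)] compatible_hd_tl[OF l l'(1)] show ?thesis
        unfolding doubleton_eq_iff by metis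
    qed
  qed
  then have "position (Ms @ [M]) (last l) = hd l" if "l \<in> L" for l
    using that Ms(3)[OF that] tl(1)[OF that] by (simp add: position_snoc last_tl)
  with Ms match show ?case by (intro exI[of _ "Ms @ [M]"]) auto
qed

section \<open>The walks of the pebbles in a routing\<close>

definition trajectory :: "nat set set list \<Rightarrow> nat \<Rightarrow> nat list" where
  "trajectory Ms v = fold (\<lambda>M l. swap_along M (hd l) # l) Ms [v]"

lemma trajectory_basic:
  "length (trajectory Ms v) = Suc (length Ms) \<and> trajectory Ms v \<noteq> [] \<and>
   hd (trajectory Ms v) = position Ms v \<and> last (trajectory Ms v) = v"
  by (induction Ms rule: rev_induct) (auto simp: trajectory_def position_def)

lemma trajectory_snoc:
  "trajectory (Ms @ [M]) v = swap_along M (position Ms v) # trajectory Ms v"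
  using trajectory_basic[of Ms v] by (simp add: trajectory_def)

lemma lazy_walk_trajectory:
  assumes "simple_graph n E" "\<forall>M \<in> set Ms. matching E M" "v \<in> {1..n}"
  shows "lazy_walk n E (trajectory Ms v)"
  using assms(2)
proof (induction Ms rule: rev_induct)
  case Nil
  with assms(3) show ?case by (simp add: trajectory_def)
next
  case (snoc M Ms)
  let ?u = "position Ms v"
  have M: "matching E M" using snoc.prems by simp
  have "position Ms permutes {1..n}" using snoc.prems position_permutes[OF assms(1)] by simp
  then have "swap_along M ?u \<in> {1..n}"
    using assms(3) swap_along_permutes[OF assms(1) M] 
    by (simp add: permutes_in_image del: atLeastAtMost_iff)
  moreover have "swap_along M ?u = ?u \<or> {?u, swap_along M ?u} \<in> E"
    using M by (cases rule: swap_along_cases[OF assms(1) M, of ?u]) (auto simp: matching_def)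
  ultimately show ?case
    using snoc trajectory_basic[of Ms v] by (simp add: trajectory_snoc lazy_walk_Cons)
qed

text \<open>Positions after each step are a permutation, so pebbles never meet. Swapping is an
  involution, so if one pebble moves to where the other stood, the other moves to where the first
  stood.\<close>

lemma compatible_trajectory:
  assumes "simple_graph n E" "\<forall>M \<in> set Ms. matching E M" "u \<noteq> v"
  shows "compatible (trajectory Ms u) (trajectory Ms v)"
  using assms(2)
proof (induction Ms rule: rev_induct)
  case Nil
  with assms(3) show ?case by (simp add: trajectory_def)
next
  case (snoc M Ms)
  have "matching E M" using snoc.prems by simp
  then have inv: "swap_along M (swap_along M a) = a" for a
    by (rule swap_along_involution[OF assms(1)])
  have "position Ms permutes {1..n}" using snoc.prems position_permutes[OF assms(1)] by simp
  then have "position Ms u \<noteq> position Ms v"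
    using assms(3) by (metis permutes_inverses(2))
  then have "swap_along M (position Ms u) \<noteq> swap_along M (position Ms v)"
    "position Ms u = swap_along M (position Ms v) \<longleftrightarrow>
      swap_along M (position Ms u) = position Ms v"
    using inv by metis+
  with snoc show ?case
    using trajectory_basic[of Ms u] trajectory_basic[of Ms v]
    by (simp add: trajectory_snoc compatible_Cons)
qed

section \<open>Clique number and maximum routability\<close>

lemma finite_perm_agreements:
  "finite {perm_agreement n \<pi> \<sigma> | \<sigma>. \<sigma> permutes {1..n} \<and> rt n E \<sigma> \<le> enat k}"
proof -
  have "finite ((perm_agreement n \<pi>) ` {\<sigma>. \<sigma> permutes {1..n}})"
    by (intro finite_imageI finite_permutations) simp
  then show ?thesis by (rule rev_finite_subset) auto
qed

lemma finite_cliques: "finite {card S | S. clique n E S}"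
proof -
  have "finite (card ` Pow {1..n})" by simp
  then show ?thesis by (rule rev_finite_subset) (auto simp: clique_def)
qed

lemma clique_number_walk_graph:
  assumes "simple_graph n E" "\<pi> permutes {1..n}"
  shows "clique_number (length (filter arrived (walks n E \<pi> k)))
    (walk_graph (filter arrived (walks n E \<pi> k))) = mr n E \<pi> k"
proof (rule antisym)
  define ws where "ws = filter arrived (walks n E \<pi> k)"
  let ?walk = "\<lambda>u. snd (ws ! (u - 1))"
  have ws: "set ws = {(hd l, l) | l. lazy_walk n E l \<and> length l = Suc k \<and> hd l = \<pi> (last l)}"
    unfolding ws_def by (auto simp: set_walks arrived_def)
  have walk: "lazy_walk n E (?walk u)" "length (?walk u) = Suc k"
    "hd (?walk u) = \<pi> (last (?walk u))" if "u \<in> {1..length ws}" for u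
  proof -
    have "ws ! (u - 1) \<in> set ws" using that by (intro nth_mem) auto
    then show "lazy_walk n E (?walk u)" "length (?walk u) = Suc k"
      "hd (?walk u) = \<pi> (last (?walk u))" unfolding ws by auto
  qed
  \<comment> \<open>The empty clique shows that the maximum is taken over a nonempty set and hence
    attained.\<close>
  have "clique (length ws) (walk_graph ws) {}" by (simp add: clique_def)
  then have "clique_number (length ws) (walk_graph ws) \<in>
      {card S | S. clique (length ws) (walk_graph ws) S}"
    unfolding clique_number_def by (intro Max_in finite_cliques) blast
  then obtain S where S: "clique (length ws) (walk_graph ws) S"
    "clique_number (length ws) (walk_graph ws) = card S" by auto
  have sub: "S \<subseteq> {1..length ws}" using S by (simp add: clique_def)
  have comp: "compatible (?walk u) (?walk v)" if "u \<in> S" "v \<in> S" "u \<noteq> v" for u v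
    using S(1) that walk_graph_iff[of u ws v] unfolding clique_def by (meson subsetD)
  have "\<exists>Ms. length Ms = k \<and> (\<forall>M \<in> set Ms. matching E M) \<and>
      (\<forall>l \<in> ?walk ` S. position Ms (last l) = hd l)"
  proof (rule compatible_family_routing[OF assms(1)])
    show "lazy_walk n E l \<and> length l = Suc k" if "l \<in> ?walk ` S" for l
      using that sub walk by auto
    show "compatible l l'" if "l \<in> ?walk ` S" "l' \<in> ?walk ` S" "l \<noteq> l'" for l l'
      using that comp by auto
  qed
  then obtain Ms where Ms: "length Ms = k" "\<forall>M \<in> set Ms. matching E M"
    "\<And>u. u \<in> S \<Longrightarrow> position Ms (last (?walk u)) = hd (?walk u)" by auto
  have perm: "position Ms permutes {1..n}" by (rule position_permutes[OF assms(1) Ms(2)])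
  \<comment> \<open>A clique vertex is sent to the start of its walk, a pebble that the routing
    takes to its target.\<close>
  have "card S \<le> card {v \<in> {1..n}. position Ms v = \<pi> v}"
  proof (rule card_inj_on_le[where f = "\<lambda>u. last (?walk u)"])
    show "inj_on (\<lambda>u. last (?walk u)) S"
      using comp compatible_last by (auto simp: inj_on_def)
    show "(\<lambda>u. last (?walk u)) ` S \<subseteq> {v \<in> {1..n}. position Ms v = \<pi> v}"
    proof
      fix v assume "v \<in> (\<lambda>u. last (?walk u)) ` S"
      then obtain u where u: "u \<in> S" "v = last (?walk u)" by auto
      then have "u \<in> {1..length ws}" using sub by auto
      note w = walk[OF this]
      have "v \<in> set (?walk u)" using u w(1) by (auto dest: lazy_walk_not_Nil)
      then have "v \<in> {1..n}" using lazy_walk_subset[OF w(1)] by blast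
      with u w(3) Ms(3)[OF u(1)] show "v \<in> {v \<in> {1..n}. position Ms v = \<pi> v}" by simp
    qed
  qed simp
  also have "\<dots> = perm_agreement n \<pi> (position Ms)"
    using perm_agreement_eq[OF assms(2) perm] by simp
  also have "\<dots> \<le> mr n E \<pi> k"
    unfolding mr_def
  proof (rule Max_ge[OF finite_perm_agreements])
    have "rt n E (position Ms) \<le> enat k" unfolding rt_le_iff using Ms by blast
    with perm show "perm_agreement n \<pi> (position Ms)
        \<in> {perm_agreement n \<pi> \<sigma> | \<sigma>. \<sigma> permutes {1..n} \<and> rt n E \<sigma> \<le> enat k}" by blast
  qed
  finally show "clique_number (length ws) (walk_graph ws) \<le> mr n E \<pi> k" using S by simp

  \<comment> \<open>The identity, routed by \<open>k\<close> empty matchings, makes the set of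
    agreements nonempty, so a best permutation exists.\<close>
  have "rt n E id \<le> enat k"
    unfolding rt_le_iff
  proof (intro exI[of _ "replicate k {}"] conjI)
    show "\<forall>v\<in>{1..n}. position (replicate k {}) v = id v"
      unfolding position_def by (induction k) (auto simp: swap_along_def)
  qed (auto simp: matching_def)
  then have "mr n E \<pi> k \<in> {perm_agreement n \<pi> \<sigma> | \<sigma>. \<sigma> permutes {1..n} \<and> rt n E \<sigma> \<le> enat k}"
    unfolding mr_def using permutes_id by (intro Max_in finite_perm_agreements) blast
  then obtain \<sigma> where \<sigma>: "\<sigma> permutes {1..n}" "rt n E \<sigma> \<le> enat k"
    "mr n E \<pi> k = perm_agreement n \<pi> \<sigma>" by auto
  then obtain Ms where Ms: "\<forall>M \<in> set Ms. matching E M" "\<And>v. v \<in> {1..n} \<Longrightarrow> position Ms v = \<sigma> v"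
    "length Ms = k" unfolding rt_le_iff by blast
  define A where "A = {v \<in> {1..n}. \<sigma> v = \<pi> v}"
  have "\<exists>u \<in> {1..length ws}. ?walk u = trajectory Ms v" if "v \<in> A" for v
  proof -
    have "(hd (trajectory Ms v), trajectory Ms v) \<in> set ws"
      unfolding ws using that trajectory_basic[of Ms v] Ms lazy_walk_trajectory[OF assms(1) Ms(1)]
      by (auto simp: A_def)
    then obtain i where "i < length ws" "ws ! i = (hd (trajectory Ms v), trajectory Ms v)"
      by (auto simp: in_set_conv_nth)
    then show ?thesis by (intro bexI[of _ "Suc i"]) auto
  qed
  then obtain index where index: "\<And>v. v \<in> A \<Longrightarrow> index v \<in> {1..length ws}"
    "\<And>v. v \<in> A \<Longrightarrow> ?walk (index v) = trajectory Ms v" by metis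
  \<comment> \<open>The pebble is recovered from its trajectory as the last entry.\<close>
  have "inj_on index A"
    using index(2) trajectory_basic by (metis inj_onI)
  moreover have "clique (length ws) (walk_graph ws) (index ` A)"
    unfolding clique_def
  proof (intro conjI ballI impI)
    fix x y assume "x \<in> index ` A" "y \<in> index ` A" "x \<noteq> y"
    then obtain u v where "u \<in> A" "v \<in> A" "x = index u" "y = index v" "u \<noteq> v" by auto
    then show "{x, y} \<in> walk_graph ws"
      using walk_graph_iff[OF index(1) index(1), of u v] index(2) compatible_trajectory[OF assms(1) Ms(1)]
      by simp
  qed (use index(1) in auto)
  then have "card (index ` A) \<le> clique_number (length ws) (walk_graph ws)"
    unfolding clique_number_def by (intro Max_ge finite_cliques) blast
  moreover have "mr n E \<pi> k = card A"
    using \<sigma> perm_agreement_eq[OF assms(2)] by (simp add: A_def)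
  ultimately show "mr n E \<pi> k \<le> clique_number (length ws) (walk_graph ws)"
    by (simp add: card_image)
qed

section \<open>Running time\<close>

lemma fst_walks_le:
  assumes "\<pi> permutes {1..n}" "w \<in> set (walks n E \<pi> k)"
  shows "fst w \<le> n"
proof -
  have "last (snd w) \<in> {1..n}"
    using walks_snd[OF assms(2)] lazy_walk_subset last_in_set by blast
  then have "\<pi> (last (snd w)) \<in> {1..n}" by (simp only: permutes_in_image[OF assms(1)])
  with walks_snd(3)[OF assms(2)] show ?thesis by simp
qed

text \<open>\<open>WALKS\<close> extends its accumulator before it calls itself, so the number
  \<open>j\<close> of rounds already done varies in the induction. Only the lists that get extended,
  those with \<open>i < j + k\<close>, have to be bounded by \<open>B\<close>.\<close>

lemma walks_runs:
  assumes "\<And>i. i < j + k \<Longrightarrow> length (walks n E \<pi> i) \<le> B"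
  shows "\<exists>t \<le> k * (B * (40 * n + 60) + 40) + 10.
     outcome prog [encode_list (encode_list encode_bool) (adjacency_matrix n E), encode_nat k,
         encode_list encode_walk (walks n E \<pi> j)] (prog ! WALKS) =
       Some (encode_list encode_walk (walks n E \<pi> (j + k)), t)"
  using assms
proof (induction k arbitrary: j)
  case 0
  then show ?case
    by (subst prog_nth) (simp add: walks_body_def)
next
  case (Suc k)
  have valid: "snd w \<noteq> [] \<and> hd (snd w) \<in> {1..n}" if "w \<in> set (walks n E \<pi> j)" for w
    using walks_snd(4,5)[OF that] by blast
  have step: "extend (adjacency_matrix n E) (walks n E \<pi> j) = walks n E \<pi> (Suc j)"
    by (simp add: walks_def)
  obtain t where "t \<le> k * (B * (40 * n + 60) + 40) + 10"
    "outcome prog [encode_list (encode_list encode_bool) (adjacency_matrix n E), encode_nat k,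
         encode_list encode_walk (walks n E \<pi> (Suc j))] (prog ! WALKS) =
       Some (encode_list encode_walk (walks n E \<pi> (Suc j + k)), t)"
    using Suc.IH[of "Suc j"] Suc.prems by auto
  moreover have "\<exists>s \<le> length (walks n E \<pi> j) * (40 * n + 60) + 10.
     outcome prog [encode_list (encode_list encode_bool) (adjacency_matrix n E),
         encode_list encode_walk (walks n E \<pi> j)] (prog ! EXTEND) =
       Some (encode_list encode_walk (extend (adjacency_matrix n E) (walks n E \<pi> j)), s)"
    by (rule extend_runs) (use adjacency_matrix_dims valid in auto)
  then obtain s where s: "s \<le> length (walks n E \<pi> j) * (40 * n + 60) + 10"
    "outcome prog [encode_list (encode_list encode_bool) (adjacency_matrix n E),
         encode_list encode_walk (walks n E \<pi> j)] (prog ! EXTEND) =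
       Some (encode_list encode_walk (walks n E \<pi> (Suc j)), s)"
    unfolding step by blast
  moreover have "s \<le> B * (40 * n + 60) + 10"
    using s(1)
  proof (rule order_trans)
    have "length (walks n E \<pi> j) \<le> B" using Suc.prems by simp
    then show "length (walks n E \<pi> j) * (40 * n + 60) + 10 \<le> B * (40 * n + 60) + 10"
      by (intro add_mono mult_mono order_refl; simp)
  qed
  ultimately show ?case
    by (subst prog_nth) (simp add: walks_body_def)
qed

text \<open>The summands pay in turn for \<open>HAS_EDGE\<close>, \<open>STARTS\<close>,
  \<open>WALKS\<close>, \<open>ARRIVED\<close>, \<open>LENGTH\<close> and \<open>ROWS\<close>; the
  constant 120 covers all constant costs.\<close>

lemma main_runs:
  assumes k'_def: "k' = (if E = {} then 0 else k)"
    and ws_def: "ws = filter arrived (walks n E \<pi> k')"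
    and "simple_graph n E" "\<pi> permutes {1..n}"
    and B: "\<And>i. i \<le> k' \<Longrightarrow> length (walks n E \<pi> i) \<le> B"
  shows "\<exists>t \<le> n * (12 * n + 30) + 20 * n + k' * (B * (40 * n + 60) + 40) + B * (10 * n + 40) +
      10 * B + B * (B * (Suc k' * (30 * n + 100) + 20) + 30) + 120.
     outcome prog [encode_graph n E, encode_perm n \<pi>, encode_nat k] (prog ! 0) =
       Some (encode_graph (length ws) (walk_graph ws), t)"
proof -
  let ?A = "adjacency_matrix n E"
  have walks_0: "starts 1 (map \<pi> [1..<Suc n]) = walks n E \<pi> 0" by (simp add: walks_def)
  have len: "length ws \<le> B"
    unfolding ws_def using B[of k'] length_filter_le le_trans by blast
  have ws: "length (snd w) = Suc k' \<and> (\<forall>v \<in> set (snd w). v \<le> n)" if "w \<in> set ws" for w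
    using that walks_snd(1,2)[of w n E \<pi> k'] lazy_walk_subset[of n E "snd w"]
    by (auto simp: ws_def)
  obtain t1 where t1: "t1 \<le> length ?A * (12 * n + 30) + 12"
    "outcome prog [encode_list (encode_list encode_bool) ?A] (prog ! HAS_EDGE) =
       Some (encode_bool (\<exists>r \<in> set ?A. True \<in> set r), t1)"
    using has_edge_runs[of ?A n] adjacency_matrix_dims(2)[of _ n E] by blast
  obtain t2 where t2: "t2 \<le> 20 * length (map \<pi> [1..<Suc n]) + 12"
    "outcome prog [encode_nat 1, encode_list encode_nat (map \<pi> [1..<Suc n])] (prog ! STARTS) =
       Some (encode_list encode_walk (walks n E \<pi> 0), t2)"
    unfolding walks_0[symmetric] using starts_runs by blast
  obtain t3 where t3: "t3 \<le> k' * (B * (40 * n + 60) + 40) + 10"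
    "outcome prog [encode_list (encode_list encode_bool) ?A, encode_nat k',
         encode_list encode_walk (walks n E \<pi> 0)] (prog ! WALKS) =
       Some (encode_list encode_walk (walks n E \<pi> k'), t3)"
    using walks_runs[of 0 k' n E \<pi> B] B by auto
  obtain t4 where t4: "t4 \<le> length (walks n E \<pi> k') * (10 * n + 40) + 10"
    "outcome prog [encode_list encode_walk (walks n E \<pi> k')] (prog ! ARRIVED) =
       Some (encode_list encode_walk ws, t4)"
    unfolding ws_def
    using arrived_runs[of "walks n E \<pi> k'" n] walks_snd(4) fst_walks_le[OF assms(4)] by blast
  obtain t5 where t5: "t5 \<le> 10 * length ws + 10"
    "outcome prog [encode_list encode_walk ws] (prog ! LENGTH) =
       Some (encode_nat (length ws), t5)"
    using length_runs by blast
  obtain t6 where t6: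
    "t6 \<le> length ws * (length ws * (Suc k' * (30 * n + 100) + 20) + 30) + 10"
    "outcome prog [encode_list encode_walk ws, encode_list encode_walk ws] (prog ! ROWS) =
       Some (encode_list (encode_list encode_bool)
         (map (\<lambda>w. map (\<lambda>w'. compatible (snd w) (snd w')) ws) ws), t6)"
    using rows_runs[of "Suc k'" ws n ws] ws by blast
  note edges = t1(2)[unfolded adjacency_matrix_has_edge[OF assms(3)]]
  have output_runs: "outcome prog [encode_list encode_walk ws] (prog ! OUTPUT) =
      Some (encode_graph (length ws) (walk_graph ws), 6 + t5 + t6)"
    using t5(2) t6(2)
    by (subst prog_nth) (simp add: output_body_def encode_graph_def adjacency_matrix_walk_graph)
  have "\<exists>t \<le> 50 + t1 + t2 + t3 + t4 + t5 + t6.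
     outcome prog [encode_graph n E, encode_perm n \<pi>, encode_nat k] (prog ! 0) =
       Some (encode_graph (length ws) (walk_graph ws), t)"
    using output_runs edges t2(2) t3(2) t4(2)
    by (subst prog_nth)
      (cases "E = {}"; simp add: main_body_def k'_def encode_graph_def[of n] encode_perm_def
         del: upt_Suc)
  then obtain t where t: "t \<le> 50 + t1 + t2 + t3 + t4 + t5 + t6"
     "outcome prog [encode_graph n E, encode_perm n \<pi>, encode_nat k] (prog ! 0) =
       Some (encode_graph (length ws) (walk_graph ws), t)" by blast
  have "t4 \<le> B * (10 * n + 40) + 10"
    using t4(1) by (rule order_trans) (intro add_mono mult_mono B order_refl; simp)
  moreover have "t6 \<le> B * (B * (Suc k' * (30 * n + 100) + 20) + 30) + 10"
    using t6(1) by (rule order_trans) (intro add_mono mult_mono len order_refl; simp)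
  ultimately have "t \<le> n * (12 * n + 30) + 20 * n + k' * (B * (40 * n + 60) + 40) +
      B * (10 * n + 40) + 10 * B + B * (B * (Suc k' * (30 * n + 100) + 20) + 30) + 120"
    using t(1) t1(1) t2(1) t3(1) t5(1) len by (simp add: adjacency_matrix_dims(1) del: upt_Suc)
  with t(2) show ?thesis by blast
qed

text \<open>Degree 4 comes from \<open>ROWS\<close>: two factors \<open>B\<close>, one
  \<open>Suc k\<close> and one \<open>n\<close>. The condition \<open>1 \<le> X\<close> lets the
  power absorb the lower terms.\<close>

lemma polynomial_bound:
  fixes n k B X :: nat
  assumes "n \<le> X" "k \<le> X" "B \<le> X" "1 \<le> X"
  shows "n * (12 * n + 30) + 20 * n + k * (B * (40 * n + 60) + 40) + B * (10 * n + 40) +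
      10 * B + B * (B * (Suc k * (30 * n + 100) + 20) + 30) + 120 \<le> 1000 * X ^ 4"
proof -
  have "n * (12 * n + 30) + 20 * n + k * (B * (40 * n + 60) + 40) + B * (10 * n + 40) +
      10 * B + B * (B * (Suc k * (30 * n + 100) + 20) + 30) + 120 \<le>
     X * (12 * X + 30) + 20 * X + X * (X * (40 * X + 60) + 40) + X * (10 * X + 40) +
      10 * X + X * (X * (Suc X * (30 * X + 100) + 20) + 30) + 120"
    using assms(1-3) by (intro add_mono mult_mono; simp)
  also have "\<dots> \<le> 1000 * X ^ 4"
  proof -
    \<comment> \<open>In terms of \<open>Y\<close>, both sides have nonnegative coefficients and the
      right side dominates coefficient by coefficient.\<close>
    obtain Y where "X = Suc Y" using assms(4) by (cases X) auto
    then show ?thesis by (simp add: algebra_simps power4_eq_xxxx)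
  qed
  finally show ?thesis .
qed

lemma max_degree_pos:
  assumes "simple_graph n E" "E \<noteq> {}"
  shows "max_degree n E \<ge> 1"
proof -
  obtain e where "e \<in> E" using assms(2) by blast
  moreover from this obtain u v where e: "e = {u, v}"
    using assms(1) by (auto simp: simple_graph_def card_2_iff)
  ultimately have uv: "{u, v} \<in> E" "u \<in> {1..n}" "v \<in> {1..n}"
    using assms(1) by (auto simp: simple_graph_def)
  have "card {v} \<le> card {w \<in> {1..n}. {u, w} \<in> E}"
    using uv by (intro card_mono) auto
  also have "\<dots> \<le> max_degree n E" by (rule card_neighbours_le[OF assms(1) uv(2)])
  finally show ?thesis by simp
qed

text \<open>Without edges the only matching is empty, so for every \<open>k\<close> just the
  permutations that fix all vertices are routable. This justifies running the program with 0
  rounds.\<close>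

lemma mr_no_edges: "mr n {} \<pi> k = mr n {} \<pi> 0"
proof -
  have "position Ms v = v" if "\<forall>M \<in> set Ms. matching {} M" for Ms v
    using that by (induction Ms) (auto simp: position_def swap_along_def matching_def)
  then have "rt n {} \<sigma> \<le> enat k \<longleftrightarrow> (\<forall>v \<in> {1..n}. v = \<sigma> v)" for \<sigma> k
    unfolding rt_le_iff
    by (auto simp: matching_def intro: exI[of _ "replicate k {}"])
  then show ?thesis by (simp add: mr_def)
qed

text \<open>Writes the bound as an explicit polynomial in \<open>n\<close> and \<open>D\<close>: the
  binomial theorem expands the power of \<open>n + 1\<close>, and \<open>D\<close> occurs only to
  the power \<open>e\<close>.\<close>

lemma expand_bound:
  fixes n D c e :: nat
  shows "c * ((n + 1) * D) ^ e =
    (\<Sum>i\<le>e. \<Sum>j\<le>e. (if j = e then c * (e choose i) else 0) * n ^ i * D ^ j)"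
proof -
  have "(\<Sum>j\<le>e. (if j = e then c * (e choose i) else 0) * n ^ i * D ^ j) =
      (\<Sum>j\<le>e. if j = e then c * (e choose i) * n ^ i * D ^ e else 0)" for i
    by (intro sum.cong) auto
  then show ?thesis
    unfolding power_mult_distrib binomial[of n 1 e]
    by (simp add: sum_distrib_left sum_distrib_right mult_ac)
qed

lemma prog_not_Nil: "prog \<noteq> []"
  by (simp add: prog_def)

theorem theorem3:
  "\<exists>(P :: program) (d :: nat) (a :: nat \<Rightarrow> nat \<Rightarrow> nat) (C :: nat).
     \<forall>(n :: nat) (E :: nat set set) (\<pi> :: nat \<Rightarrow> nat) (k :: nat).
       simple_graph n E \<longrightarrow> \<pi> permutes {1..n} \<longrightarrow> k \<ge> 1 \<longrightarrow>
       (let D = (max_degree n E + 1) ^ k in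
        \<exists>(m :: nat) (F :: nat set set) (t :: nat).
          simple_graph m F \<and>
          computes_in P [encode_graph n E, encode_perm n \<pi>, encode_nat k] (encode_graph m F) t \<and>
          t \<le> (\<Sum>i\<le>d. \<Sum>j\<le>d. a i j * n ^ i * D ^ j) \<and>
          m \<le> C * (n * D) \<and>
          clique_number m F = mr n E \<pi> k)"
proof (rule exI[of _ prog], rule exI[of _ 4],
    rule exI[of _ "\<lambda>i j. if j = 4 then 1000 * (4 choose i) else 0"], rule exI[of _ 1],
    intro allI impI)
  \<comment> \<open>The witnesses come from expanding \<open>1000 * ((n + 1) * D) ^ 4\<close>. The
    factor 1 in the size bound is the count of at most \<open>n * D\<close> walks.\<close>
  fix n :: nat and E :: "nat set set" and \<pi> :: "nat \<Rightarrow> nat" and k :: nat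
  assume graph: "simple_graph n E" and perm: "\<pi> permutes {1..n}"
  define D where "D = (max_degree n E + 1) ^ k"
  define k' where "k' = (if E = {} then 0 else k)"
  define ws where "ws = filter arrived (walks n E \<pi> k')"
  have B: "length (walks n E \<pi> i) \<le> n * D" if "i \<le> k'" for i
  proof -
    have "i \<le> k" using that by (simp add: k'_def split: if_splits)
    then have "(max_degree n E + 1) ^ i \<le> D" unfolding D_def by (intro power_increasing) auto
    then have "n * (max_degree n E + 1) ^ i \<le> n * D" by (rule mult_le_mono2)
    with length_walks_le[OF graph] show ?thesis by (rule order_trans)
  qed
  then have "length (walks n E \<pi> k') \<le> n * D" by simp
  then have len: "length ws \<le> 1 * (n * D)"
    unfolding ws_def using length_filter_le[of arrived "walks n E \<pi> k'"] by linarith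
  have "k' \<le> D"
  proof (cases "E = {}")
    case False
    have "k < 2 ^ k" by (rule less_exp)
    also have "2 ^ k \<le> D"
      unfolding D_def using max_degree_pos[OF graph False] by (intro power_mono) auto
    finally show ?thesis using False by (simp add: k'_def)
  qed (simp add: k'_def)
  moreover have "1 \<le> D" by (simp add: D_def)
  \<comment> \<open>The common bound is \<open>(n + 1) * D\<close> and not \<open>n * D\<close>,
    since it must be at least 1 even when \<open>n\<close> is 0.\<close>
  ultimately have X: "n \<le> (n + 1) * D" "k' \<le> (n + 1) * D" "n * D \<le> (n + 1) * D" "1 \<le> (n + 1) * D"
  proof -
    assume D: "k' \<le> D" "1 \<le> D"
    show "n \<le> (n + 1) * D" using mult_le_mono[OF le_add1[of n 1] D(2)] by simp
    show "k' \<le> (n + 1) * D" "1 \<le> (n + 1) * D" using D by (simp_all add: trans_le_add1)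
    show "n * D \<le> (n + 1) * D" by simp
  qed
  obtain t where bound: "t \<le> n * (12 * n + 30) + 20 * n + k' * (n * D * (40 * n + 60) + 40) +
      n * D * (10 * n + 40) + 10 * (n * D) +
      n * D * (n * D * (Suc k' * (30 * n + 100) + 20) + 30) + 120"
    and run: "outcome prog [encode_graph n E, encode_perm n \<pi>, encode_nat k] (prog ! 0) =
       Some (encode_graph (length ws) (walk_graph ws), t)"
    using main_runs[OF k'_def ws_def graph perm B] by blast
  have t: "t \<le> 1000 * ((n + 1) * D) ^ 4"
    using bound polynomial_bound[OF X] by (rule order_trans)
  have "mr n E \<pi> k' = mr n E \<pi> k"
    using mr_no_edges[of n \<pi> k] by (simp add: k'_def)
  then have "clique_number (length ws) (walk_graph ws) = mr n E \<pi> k"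
    using clique_number_walk_graph[OF graph perm, of k'] by (simp add: ws_def)
  moreover have "computes_in prog [encode_graph n E, encode_perm n \<pi>, encode_nat k]
      (encode_graph (length ws) (walk_graph ws)) t"
    using run by (simp add: computes_in_def outcome_eq_Some prog_not_Nil)
  ultimately show "let D = (max_degree n E + 1) ^ k in
        \<exists>(m :: nat) (F :: nat set set) (t :: nat).
          simple_graph m F \<and>
          computes_in prog [encode_graph n E, encode_perm n \<pi>, encode_nat k]
            (encode_graph m F) t \<and>
          t \<le> (\<Sum>i\<le>4. \<Sum>j\<le>4. (if j = 4 then 1000 * (4 choose i) else 0) * n ^ i * D ^ j) \<and>
          m \<le> 1 * (n * D) \<and>
          clique_number m F = mr n E \<pi> k"
    unfolding Let_def D_def[symmetric] expand_bound[symmetric]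
    using simple_walk_graph t len
    by (intro exI[of _ "length ws"] exI[of _ "walk_graph ws"] exI[of _ t] conjI)
qed

end
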